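(* Let $\mathbf{Z}=(Z_n)_{n\ge 0}$ be the balanced excited random walk in $2=1+1$ dimensions, and let $D\subset\mathbb{Z}^2$ be its (random) set of recurrent vertices. Then $$\mathbb{P}\big(D\in\{\varnothing,\mathbb{Z}^2\}\big)=1.$$
   Context: The balanced excited random walk (BERW) in $2=1+1$ dimensions is the following nearest-neighbour walk $\mathbf{Z}=(Z_n)_{n\ge0}$ on $\mathbb{Z}^2$ started at $Z_0=(0,0)$. On the first departure from each site, the walk makes a vertical step ($\pm(0,1)$); on all subsequent departures from that site, it makes a horizontal step ($\pm(1,0)$). In each case the step is to one of the two corresponding neighbours with probability $1/2$ each, independently of all previous randomness. A vertex $x\in\mathbb{Z}^2$ is recurrent for the trajectory if $Z_i=x$ for infinitely many $i\ge 0$. $D$ denotes the set of recurrent vertices of $\mathbf{Z}$. *)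

theory Defs
  imports "HOL-Probability.Probability"
begin

text \<open>Law of the position at time \<open>n + 1\<close> given the trajectory \<open>z 0, \<dots>, z n\<close>. The departure from
  \<open>z n\<close> at time \<open>n\<close> is the first one from that site iff \<open>z\<close> was not at \<open>z n\<close> before time \<open>n\<close>.\<close>
definition berw_step :: "(nat \<Rightarrow> int \<times> int) \<Rightarrow> nat \<Rightarrow> (int \<times> int) pmf" where
  "berw_step z n =
    (if \<forall>k<n. z k \<noteq> z n
     then pmf_of_set {z n + (0, 1), z n - (0, 1)}
     else pmf_of_set {z n + (1, 0), z n - (1, 0)})"

text \<open>A process is a balanced excited random walk if it has the right law: it need not live on
  a canonical probability space. As the state space is countable, it suffices to condition on the
  elementary past events of positive probability.\<close>
locale balanced_excited_random_walk = prob_space M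
  for M :: "'w measure" and Z :: "nat \<Rightarrow> 'w \<Rightarrow> int \<times> int" +
  assumes measurable_Z: "\<And>n. Z n \<in> measurable M (count_space UNIV)"
    and start: "AE \<omega> in M. Z 0 \<omega> = (0, 0)"
    and step: "\<And>n z y. \<P>(\<omega> in M. \<forall>k\<le>n. Z k \<omega> = z k) > 0 \<Longrightarrow>
      \<P>(\<omega> in M. Z (Suc n) \<omega> = y \<bar> \<forall>k\<le>n. Z k \<omega> = z k) = pmf (berw_step z n) y"

definition recurrent_vertices :: "(nat \<Rightarrow> int \<times> int) \<Rightarrow> (int \<times> int) set" where
  "recurrent_vertices z = {x. infinite {i. z i = x}}"

end

theory Submission
  imports Defs
begin

text \<open>
  Attach to every site a stack of independent fair coins that decide its successive departures. If
  \<open>x\<close> is recurrent then so are its horizontal neighbours, so the recurrent set is a union of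
  horizontal lines, and it remains to show that a line next to a recurrent line is recurrent. If
  line 0 is recurrent, every first departure from it takes place, so the numbers of visits of the
  walk to the half plane above dominate the least solution \<open>u\<close> of the recursion "visits equal
  arrivals" in which every site of line 0 departs exactly once. This \<open>u\<close> depends on the coins in a
  translation equivariant way, so by ergodicity each line is almost surely entirely transient
  (\<open>u\<close> finite) or entirely recurrent for \<open>u\<close>. Conservation of mass on a transient line shows that
  the probability of being visited is harmonic in the height; being bounded, it equals 1 if line 1
  is transient. Then the net flow through the edges of line 1 is a stationary process whose
  increments are sums of two independent centred coins, which is absurd.
\<close>

section \<open>Families of independent fair coins\<close>

text \<open>The coins are never conditioned on the recurrence of a line: that event depends on the
  whole walk and would destroy independence. Instead \<open>visits\<close> is built from all coins
  of a half plane, whether or not the walk ever gets there, and the comparison with the walk is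
  deterministic. Almost sure statements about \<open>visits\<close> then hold for all of the
  countably many lines and both sides at once. The translation invariance that the walk started at
  the origin lacks comes from the same construction. The order of departures does not enter, since
  only counts are compared. The flow is not known to be integrable, which is why its mean increment
  is computed by truncation and its failure to be tight is seen through \<open>cos\<close> rather
  than through moments.\<close>

abbreviation fair_coin :: "bool measure" where
  "fair_coin \<equiv> measure_pmf (bernoulli_pmf (1 / 2))"

definition coins :: "('i \<Rightarrow> bool) measure" where
  "coins = PiM UNIV (\<lambda>_. fair_coin)"

definition cyl :: "'i set \<Rightarrow> ('i \<Rightarrow> bool set) \<Rightarrow> ('i \<Rightarrow> bool) set" where
  "cyl J E = {\<omega>. \<forall>i\<in>J. \<omega> i \<in> E i}"

lemma product_prob_space_fair: "product_prob_space (\<lambda>_::'i. fair_coin)"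
  by (intro product_prob_spaceI measure_pmf.prob_space_axioms)

lemma prob_space_coins: "prob_space (coins :: ('i \<Rightarrow> bool) measure)"
  unfolding coins_def by (intro prob_space_PiM measure_pmf.prob_space_axioms)

interpretation coins: prob_space "coins :: ('i \<Rightarrow> bool) measure"
  by (rule prob_space_coins)

lemma space_coins [simp]: "space coins = UNIV"
  by (simp add: coins_def space_PiM)

lemma measurable_coin [measurable]: "(\<lambda>\<omega>. \<omega> i) \<in> measurable coins (count_space UNIV)"
proof -
  have "(\<lambda>\<omega>. \<omega> i) \<in> measurable coins fair_coin"
    unfolding coins_def by (rule measurable_component_singleton) simp
  then show ?thesis by (simp add: measurable_def)
qed

lemma measurable_into_coins:
  assumes "\<And>i. (\<lambda>x. f x i) \<in> measurable M (count_space UNIV)"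
  shows "f \<in> measurable M coins"
proof -
  have "(\<lambda>x. \<lambda>i\<in>UNIV. f x i) \<in> measurable M coins"
    unfolding coins_def
  proof (rule measurable_restrict)
    fix i show "(\<lambda>x. f x i) \<in> measurable M fair_coin"
      using assms[of i] by (simp add: measurable_def)
  qed
  then show ?thesis by (simp add: restrict_def)
qed

lemma cyl_eq_prod_emb: "cyl J E = prod_emb UNIV (\<lambda>_. fair_coin) J (Pi\<^sub>E J E)"
  by (auto simp: cyl_def prod_emb_def)

lemma sets_cyl [measurable]: "finite J \<Longrightarrow> cyl J E \<in> sets coins"
  unfolding coins_def cyl_eq_prod_emb by (rule sets_PiM_I) auto

lemma prob_cyl:
  fixes J :: "'i set"
  assumes "finite J"
  shows "measure coins (cyl J E) = (\<Prod>i\<in>J. measure fair_coin (E i))"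
proof -
  interpret product_prob_space "\<lambda>_::'i. fair_coin" UNIV by (rule product_prob_space_fair)
  show ?thesis
    unfolding coins_def cyl_eq_prod_emb by (rule measure_PiM_emb) (auto simp: assms)
qed

lemma sets_coins: "sets (coins :: ('i \<Rightarrow> bool) measure) = sigma_sets UNIV {cyl J E | J E. finite J}"
proof -
  have "prod_algebra (UNIV :: 'i set) (\<lambda>_. fair_coin) = {cyl J E | J E. finite J}"
  proof (intro set_eqI iffI)
    fix A :: "('i \<Rightarrow> bool) set"
    assume "A \<in> prod_algebra UNIV (\<lambda>_. fair_coin)"
    then show "A \<in> {cyl J E | J E. finite J}"
      by (elim prod_algebraE) (auto simp: cyl_eq_prod_emb)
  next
    fix A :: "('i \<Rightarrow> bool) set"
    assume "A \<in> {cyl J E | J E. finite J}"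
    then obtain J E where A: "A = cyl J E" "finite J" by blast
    show "A \<in> prod_algebra UNIV (\<lambda>_. fair_coin)"
    proof (cases "J = {}")
      case True
      \<comment> \<open>\<open>prod_algebra\<close> over a nonempty index set admits only nonempty
        \<open>J\<close>, so the trivial cylinder is written over one arbitrary coordinate.\<close>
      then have "A = cyl {undefined} (\<lambda>_. UNIV)" using A by (simp add: cyl_def)
      then show ?thesis unfolding cyl_eq_prod_emb by (auto intro!: prod_algebraI)
    next
      case False
      then show ?thesis using A unfolding cyl_eq_prod_emb by (auto intro!: prod_algebraI)
    qed
  qed
  then show ?thesis
    unfolding coins_def sets_PiM
    by (simp only: space_measure_pmf PiE_UNIV_domain UNIV_I simp_thms Collect_const if_True Pi_UNIV)
qed

lemma cyl_Int: "cyl J E \<inter> cyl J' E' =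
    cyl (J \<union> J') (\<lambda>i. (if i \<in> J then E i else UNIV) \<inter> (if i \<in> J' then E' i else UNIV))"
  unfolding cyl_def by (rule set_eqI) (simp add: Ball_def, blast)

lemma Int_stable_cyl: "Int_stable {cyl J E | (J :: 'i set) E. finite J}"
proof (rule Int_stableI)
  fix A B :: "('i \<Rightarrow> bool) set"
  assume "A \<in> {cyl J E | J E. finite J}" "B \<in> {cyl J E | J E. finite J}"
  then obtain J J' :: "'i set" and E E' where "A = cyl J E" "B = cyl J' E'" "finite (J \<union> J')" by auto
  then show "A \<inter> B \<in> {cyl J E | J E. finite J}" using cyl_Int by blast
qed

text \<open>Equating booleans is a flip: the coin \<open>h i\<close> is kept where
  \<open>s i\<close> is true and negated elsewhere. This one map covers translations, the flip of a
  single coin and the passage from the coins of the walk to those of a half plane.\<close>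

lemma measurable_recode:
  "(\<lambda>\<omega> i. \<omega> (h i) = s i) \<in> measurable coins coins"
  by (rule measurable_into_coins) measurable

lemma map_fair_coin_eq: "map_pmf (\<lambda>b. b = c) (bernoulli_pmf (1 / 2)) = bernoulli_pmf (1 / 2)"
proof -
  have bij: "bij (\<lambda>b::bool. b = c)" by (rule involuntory_imp_bij) auto
  then have "map_pmf (\<lambda>b. b = c) (pmf_of_set (UNIV :: bool set)) = pmf_of_set (range (\<lambda>b. b = c))"
    by (intro map_pmf_of_set_inj) (auto simp: bij_def)
  then show ?thesis using bij by (simp add: bernoulli_pmf_half_conv_pmf_of_set bij_def)
qed

lemma measure_fair_coin_eq: "measure fair_coin {b. (b = c) \<in> X} = measure fair_coin X"
  by (subst (2) map_fair_coin_eq[symmetric, of c]) (simp add: measure_map_pmf vimage_def)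

text \<open>Injectivity of \<open>h\<close> makes distinct indices read distinct coins, so a finite
  cylinder pulls back to a finite cylinder with the same factors, up to flips that leave a fair coin
  unchanged in law.\<close>

lemma distr_coins_recode:
  fixes h :: "'i \<Rightarrow> 'j"
  assumes "inj h"
  shows "distr coins coins (\<lambda>\<omega> i. \<omega> (h i) = s i) = coins"
proof -
  interpret product_prob_space "\<lambda>_::'i. fair_coin" UNIV by (rule product_prob_space_fair)
  let ?T = "\<lambda>\<omega> i. \<omega> (h i) = s i"
  have "distr coins coins ?T = PiM UNIV (\<lambda>_. fair_coin)"
  proof (rule PiM_eq)
    show "sets (distr coins coins ?T) = sets (PiM UNIV (\<lambda>_. fair_coin))"
      by (simp add: coins_def)
    fix J :: "'i set" and F :: "'i \<Rightarrow> bool set"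
    assume J: "finite J"
    have vim: "?T -` cyl J F = cyl (h ` J) (\<lambda>i. {b. (b = s (inv h i)) \<in> F (inv h i)})"
      by (auto simp: cyl_def inv_f_f[OF assms])
    have "emeasure (distr coins coins ?T) (cyl J F) = emeasure coins (?T -` cyl J F)"
      using J by (subst emeasure_distr[OF measurable_recode]) auto
    also have "\<dots> = (\<Prod>i\<in>J. emeasure fair_coin (F i))"
      using J inj_on_subset[OF assms, of J]
      by (simp add: vim coins.emeasure_eq_measure prob_cyl prod.reindex inv_f_f[OF assms]
          measure_fair_coin_eq measure_pmf.emeasure_eq_measure prod_ennreal)
    finally show "emeasure (distr coins coins ?T) (prod_emb UNIV (\<lambda>_. fair_coin) J (Pi\<^sub>E J F)) =
        (\<Prod>i\<in>J. emeasure fair_coin (F i))"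
      by (simp add: cyl_eq_prod_emb)
  qed
  then show ?thesis by (simp add: coins_def)
qed

lemma prob_recode:
  assumes "inj h" "A \<in> sets coins"
  shows "measure coins {\<omega>. (\<lambda>i. \<omega> (h i) = s i) \<in> A} = measure coins A"
proof -
  have "measure coins A = measure (distr coins coins (\<lambda>\<omega> i. \<omega> (h i) = s i)) A"
    by (simp add: distr_coins_recode[OF assms(1)])
  also have "\<dots> = measure coins ((\<lambda>\<omega> i. \<omega> (h i) = s i) -` A \<inter> space coins)"
    by (rule measure_distr[OF measurable_recode assms(2)])
  finally show ?thesis by (simp add: vimage_def)
qed

lemma sets_recode:
  assumes "A \<in> sets coins"
  shows "{\<omega>. (\<lambda>i. \<omega> (h i) = s i) \<in> A} \<in> sets coins"
  using measurable_sets[OF measurable_recode assms, of h s] by (simp add: vimage_def)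

lemma AE_recode:
  assumes "inj h" "AE \<omega> in coins. P \<omega>"
  shows "AE \<omega> in coins. P (\<lambda>i. \<omega> (h i) = s i)"
proof (rule AE_distrD[OF measurable_recode])
  show "AE x in distr coins coins (\<lambda>\<omega> i. \<omega> (h i) = s i). P x"
    unfolding distr_coins_recode[OF assms(1)] by (rule assms(2))
qed

lemma integral_recode:
  fixes f :: "('i \<Rightarrow> bool) \<Rightarrow> 'b::{banach, second_countable_topology}"
  assumes "inj h" "f \<in> borel_measurable coins"
  shows "(\<integral>\<omega>. f (\<lambda>i. \<omega> (h i) = s i) \<partial>coins) = (\<integral>\<omega>. f \<omega> \<partial>coins)"
proof -
  have "(\<integral>\<omega>. f \<omega> \<partial>coins) = (\<integral>\<omega>. f \<omega> \<partial>distr coins coins (\<lambda>\<omega> i. \<omega> (h i) = s i))"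
    by (simp add: distr_coins_recode[OF assms(1)])
  also have "\<dots> = (\<integral>\<omega>. f (\<lambda>i. \<omega> (h i) = s i) \<partial>coins)"
    by (rule integral_distr[OF measurable_recode assms(2)])
  finally show ?thesis by simp
qed

section \<open>Mixing and the zero-one law under recoding of indices\<close>

lemma prob_cyl_Int_disjoint:
  assumes "finite J" "finite J'" "J \<inter> J' = {}"
  shows "measure coins (cyl J E \<inter> cyl J' E') = measure coins (cyl J E) * measure coins (cyl J' E')"
proof -
  have "measure coins (cyl J E \<inter> cyl J' E') = (\<Prod>i\<in>J \<union> J'. measure fair_coin
      ((if i \<in> J then E i else UNIV) \<inter> (if i \<in> J' then E' i else UNIV)))"
    unfolding cyl_Int using assms by (intro prob_cyl) auto
  also have "\<dots> = (\<Prod>i\<in>J. measure fair_coin (E i)) * (\<Prod>i\<in>J'. measure fair_coin (E' i))"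
    using assms by (subst prod.union_disjoint) (auto intro!: arg_cong2[where f="(*)"] prod.cong)
  finally show ?thesis using assms by (simp add: prob_cyl)
qed

text \<open>Two cylinders become independent as soon as \<open>h n\<close> has moved the coordinates
  of one off those of the other. With the second cylinder fixed, the limit passes to every event
  \<open>A\<close> by induction over the generated sigma-algebra.\<close>

lemma coins_mixing:
  fixes h :: "nat \<Rightarrow> 'i \<Rightarrow> 'i"
  assumes inj: "\<And>n. inj (h n)"
    and away: "\<And>i i'. eventually (\<lambda>n. h n i \<noteq> i') sequentially"
    and J: "finite J" and A: "A \<in> sets coins"
  shows "(\<lambda>n. measure coins ({\<omega>. (\<lambda>i. \<omega> (h n i)) \<in> A} \<inter> cyl J E)) \<longlonglongrightarrow>
    measure coins A * measure coins (cyl J E)"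
proof -
  note [measurable] = sets_cyl[OF J]
  let ?C = "cyl J E" and ?S = "\<lambda>n A. {\<omega>. (\<lambda>i. \<omega> (h n i)) \<in> A}"
  have sets_S: "?S n A \<in> sets coins" if "A \<in> sets coins" for n A
    using sets_recode[OF that, of "h n" "\<lambda>_. True"] by simp
  have prob_S: "measure coins (?S n A) = measure coins A" if "A \<in> sets coins" for n A
    using prob_recode[OF inj that, of n "\<lambda>_. True"] by simp
  have gen: "A \<in> sigma_sets UNIV {cyl J E | J E. finite J}" "{cyl J E | J E. finite J} \<subseteq> Pow UNIV"
    using A by (simp_all add: sets_coins)
  show ?thesis
    using Int_stable_cyl gen(2,1)
  proof (induction A rule: sigma_sets_induct_disjoint)
    case (basic A)
    then obtain J' E' where A: "A = cyl J' E'" and J': "finite J'" by blast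
    have "eventually (\<lambda>n. \<forall>i\<in>J'. \<forall>i'\<in>J. h n i \<noteq> i') sequentially"
      using J J' away by (simp add: eventually_ball_finite_distrib)
    then have "eventually (\<lambda>n. measure coins A * measure coins ?C =
      measure coins (?S n A \<inter> ?C)) sequentially"
    proof eventually_elim
      case (elim n)
      have eq: "?S n A = cyl (h n ` J') (\<lambda>i. E' (inv (h n) i))"
        by (auto simp: A cyl_def inv_f_f[OF inj])
      have "measure coins (?S n A \<inter> ?C) = measure coins (?S n A) * measure coins ?C"
        unfolding eq using J J' elim by (intro prob_cyl_Int_disjoint) auto
      also have "measure coins (?S n A) = measure coins A"
        by (rule prob_S) (simp add: A J')
      finally show ?case by simp
    qed
    then show ?case by (rule tendsto_eventually[OF eventually_mono]) simp
  next
    case empty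
    show ?case by simp
  next
    case (compl A)
    then have A: "A \<in> sets coins" by (simp add: sets_coins)
    have eq: "measure coins (?S n (UNIV - A) \<inter> ?C) = measure coins ?C - measure coins (?S n A \<inter> ?C)" for n
    proof -
      have "?S n (UNIV - A) \<inter> ?C = ?C - (?S n A \<inter> ?C)" by auto
      then show ?thesis
        using sets_S[OF A] by (simp add: coins.finite_measure_Diff)
    qed
    have "measure coins (UNIV - A) = 1 - measure coins A"
      using coins.prob_compl[OF A] by simp
    then show ?case
      unfolding eq using tendsto_diff[OF tendsto_const compl.IH]
      by (simp only: left_diff_distrib mult_1_left)
  next
    case (union A)
    then have A: "A i \<in> sets coins" for i by (auto simp: sets_coins)
    have sums: "(\<lambda>i. measure coins (?S n (A i) \<inter> ?C)) sums measure coins (?S n (\<Union>i. A i) \<inter> ?C)" for n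
    proof -
      have "(\<lambda>i. measure coins (?S n (A i) \<inter> ?C)) sums measure coins (\<Union>i. ?S n (A i) \<inter> ?C)"
      proof (rule coins.finite_measure_UNION)
        show "disjoint_family (\<lambda>i. ?S n (A i) \<inter> ?C)"
          using \<open>disjoint_family A\<close> by (auto simp: disjoint_family_on_def disjoint_iff)
      qed (use sets_S[OF A] in auto)
      moreover have "(\<Union>i. ?S n (A i) \<inter> ?C) = ?S n (\<Union>i. A i) \<inter> ?C" by auto
      ultimately show ?thesis by simp
    qed
    have sumsA: "(\<lambda>i. measure coins (A i)) sums measure coins (\<Union>i. A i)"
      by (rule coins.finite_measure_UNION) (use A \<open>disjoint_family A\<close> in auto)
    \<comment> \<open>Limit and infinite sum are exchanged by Tannery's theorem; the majorant
      \<open>measure coins (A i)\<close> does not involve \<open>n\<close> because recoding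
      preserves the measure.\<close>
    have "((\<lambda>n. \<Sum>i. measure coins (?S n (A i) \<inter> ?C)) \<longlongrightarrow>
        (\<Sum>i. measure coins (A i) * measure coins ?C)) sequentially"
    proof (rule conjunct2[OF conjunct2[OF tannerys_theorem]])
      show "summable (\<lambda>i. measure coins (A i))" using sumsA by (rule sums_summable)
      show "eventually (\<lambda>(i, n). norm (measure coins (?S n (A i) \<inter> ?C)) \<le> measure coins (A i))
          (at_top \<times>\<^sub>F sequentially)"
      proof (rule always_eventually, clarify)
        fix i n
        have "measure coins (?S n (A i) \<inter> ?C) \<le> measure coins (?S n (A i))"
          by (rule coins.finite_measure_mono) (use sets_S[OF A] in auto)
        then show "norm (measure coins (?S n (A i) \<inter> ?C)) \<le> measure coins (A i)"
          by (simp add: prob_S[OF A])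
      qed
    qed (use union.IH in auto)
    then show ?case
      using sums_unique[OF sums] sums_unique[OF sums_mult2[OF sumsA]] by simp
  qed
qed

text \<open>An invariant event is asymptotically independent of every cylinder, hence independent
  of itself.\<close>

lemma coins_invariant_zero_one:
  fixes h :: "nat \<Rightarrow> 'i \<Rightarrow> 'i"
  assumes inj: "\<And>n. inj (h n)"
    and away: "\<And>i i'. eventually (\<lambda>n. h n i \<noteq> i') sequentially"
    and A: "A \<in> sets coins" and invariant: "\<And>n \<omega>. (\<lambda>i. \<omega> (h n i)) \<in> A \<longleftrightarrow> \<omega> \<in> A"
  shows "measure coins A = 0 \<or> measure coins A = 1"
proof -
  have cyl: "measure coins (A \<inter> cyl J E) = measure coins A * measure coins (cyl J E)"
    if "finite J" for J E
    using coins_mixing[OF inj away that A, of E] by (simp add: invariant LIMSEQ_const_iff)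
  have "coins.indep_set {A} {cyl J E | J E. finite J}"
    using A cyl by (intro coins.indep_setI) auto
  then have "coins.indep_set (sigma_sets (space coins) {A}) (sigma_sets (space coins) {cyl J E | J E. finite J})"
    by (rule coins.indep_set_sigma_sets[OF _ _ Int_stable_cyl]) (simp add: Int_stable_def)
  moreover have "A \<in> sigma_sets (space coins) {A}"
    "A \<in> sigma_sets (space coins) {cyl J E | J E. finite J}"
    using A by (auto simp: sets_coins)
  ultimately have "measure coins (A \<inter> A) = measure coins A * measure coins A"
    by (rule coins.indep_setD)
  then show ?thesis by simp
qed

lemma prob_coin: "measure coins {\<omega>. \<omega> i = b} = 1 / 2"
proof -
  have "{\<omega>. \<omega> i = b} = cyl {i} (\<lambda>_. {b})" by (simp add: cyl_def)
  then show ?thesis by (cases b) (simp_all add: prob_cyl measure_pmf_single)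
qed

lemma AE_coins_infinitely_often:
  fixes f :: "nat \<Rightarrow> 'i"
  assumes "inj f"
  shows "AE \<omega> in coins. \<exists>\<^sub>\<infinity>k. \<omega> (f k) = b"
proof -
  have "AE \<omega> in coins. \<exists>k\<ge>m. \<omega> (f k) = b" for m
  proof -
    let ?N = "{\<omega>. \<forall>k\<ge>m. \<omega> (f k) \<noteq> b}"
    have "?N \<in> sets coins"
    proof -
      have "{\<omega> \<in> space coins. \<forall>k\<ge>m. \<omega> (f k) \<noteq> b} \<in> sets coins" by measurable
      then show ?thesis by simp
    qed
    have le: "measure coins ?N \<le> (1 / 2) ^ n" for n
    proof -
      have "measure coins ?N \<le> measure coins (cyl (f ` {m..<m + n}) (\<lambda>_. {\<not> b}))"
      proof (rule coins.finite_measure_mono)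
        show "?N \<subseteq> cyl (f ` {m..<m + n}) (\<lambda>_. {\<not> b})" by (auto simp: cyl_def)
      qed simp
      also have "\<dots> = (\<Prod>i\<in>f ` {m..<m + n}. 1 / 2)"
        by (subst prob_cyl) (cases b; simp add: measure_pmf_single)+
      also have "\<dots> = (1 / 2) ^ n"
        using inj_on_subset[OF assms] by (simp add: card_image)
      finally show ?thesis .
    qed
    have "(\<lambda>n. (1 / 2) ^ n :: real) \<longlonglongrightarrow> 0" by (rule LIMSEQ_power_zero) simp
    then have "measure coins ?N \<le> 0" by (rule LIMSEQ_le_const) (use le in auto)
    then have "measure coins ?N = 0" by (simp add: measure_le_0_iff)
    then have "?N \<in> null_sets coins"
      using \<open>?N \<in> sets coins\<close>
      by (simp only: null_sets_def mem_Collect_eq coins.emeasure_eq_measure ennreal_0 simp_thms)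
    then show ?thesis by (rule AE_I') auto
  qed
  then have "AE \<omega> in coins. \<forall>m. \<exists>k\<ge>m. \<omega> (f k) = b" by (simp add: AE_all_countable)
  then show ?thesis by (simp add: INFM_nat_le)
qed

lemma indep_vars_coins: "coins.indep_vars (\<lambda>_. count_space UNIV) (\<lambda>i \<omega>. \<omega> i) I"
proof -
  have "coins.indep_sets (\<lambda>i. {(\<lambda>\<omega>. \<omega> i) -` A \<inter> space coins |A. A \<in> sets (count_space UNIV)}) I"
    unfolding coins.indep_sets_def
  proof (intro conjI ballI allI impI)
    fix i :: 'a
    show "{(\<lambda>\<omega>. \<omega> i) -` A \<inter> space coins |A. A \<in> sets (count_space UNIV)} \<subseteq> sets coins"
      by (auto simp del: space_coins intro: measurable_sets[OF measurable_coin[of i]])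
  next
    fix A and J :: "'a set"
    assume J: "finite J"
      and A: "A \<in> (\<Pi> i\<in>J. {(\<lambda>\<omega>. \<omega> i) -` A \<inter> space coins |A. A \<in> sets (count_space UNIV)})"
    have "\<forall>i\<in>J. \<exists>B. A i = cyl {i} (\<lambda>_. B)"
    proof
      fix i assume "i \<in> J"
      with A obtain B where "A i = (\<lambda>\<omega>. \<omega> i) -` B" by (auto dest: Pi_mem)
      then have "A i = cyl {i} (\<lambda>_. B)" by (simp add: cyl_def vimage_def)
      then show "\<exists>B. A i = cyl {i} (\<lambda>_. B)" by blast
    qed
    from bchoice[OF this] obtain B where B: "\<And>i. i \<in> J \<Longrightarrow> A i = cyl {i} (\<lambda>_. B i)" by blast
    then have "(\<Inter>i\<in>J. A i) = cyl J B" by (simp add: cyl_def set_eq_iff)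
    then show "measure coins (\<Inter>i\<in>J. A i) = (\<Prod>i\<in>J. measure coins (A i))"
      using J by (simp add: prob_cyl B)
  qed
  then show ?thesis by (simp add: coins.indep_vars_def2)
qed

lemma integral_coin:
  fixes f :: "bool \<Rightarrow> 'b::{banach, second_countable_topology}"
  shows "(\<integral>\<omega>. f (\<omega> i) \<partial>coins) = (1 / 2) *\<^sub>R (f True + f False)"
proof -
  have m: "{\<omega>. \<omega> i = b} \<in> sets coins" for b
    using measurable_sets[OF measurable_coin, of "{b}" i] by (simp add: vimage_def)
  have int: "integrable coins (\<lambda>\<omega>. indicator {\<omega>. \<omega> i = b} \<omega> :: real)" for b
    using m by (simp add: coins.emeasure_eq_measure)
  have "f (\<omega> i) = indicator {\<omega>. \<omega> i = True} \<omega> *\<^sub>R f True + indicator {\<omega>. \<omega> i = False} \<omega> *\<^sub>R f False" for \<omega>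
    by (cases "\<omega> i") auto
  then have "(\<integral>\<omega>. f (\<omega> i) \<partial>coins) =
      (\<integral>\<omega>. indicator {\<omega>. \<omega> i = True} \<omega> *\<^sub>R f True + indicator {\<omega>. \<omega> i = False} \<omega> *\<^sub>R f False \<partial>coins)"
    by presburger
  also have "\<dots> = measure coins {\<omega>. \<omega> i = True} *\<^sub>R f True + measure coins {\<omega>. \<omega> i = False} *\<^sub>R f False"
    by (simp only: Bochner_Integration.integral_add int integrable_scaleR_left integral_scaleR_left
        Int_UNIV_right space_coins Bochner_Integration.integral_indicator)
  finally show ?thesis unfolding prob_coin by (simp add: scaleR_add_right)
qed

text \<open>\<open>F\<close> need not be integrable, so the integral cannot be split. Truncation at
  level \<open>K\<close> is 1-Lipschitz, which keeps the difference below \<open>C\<close>, while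
  invariance of the measure makes each truncated mean vanish; dominated convergence then removes the
  truncation.\<close>

lemma coins_coboundary_integral_zero:
  fixes F :: "('i \<Rightarrow> bool) \<Rightarrow> real"
  assumes inj: "inj h" and F [measurable]: "F \<in> borel_measurable coins"
    and bound: "AE \<omega> in coins. \<bar>F (\<lambda>i. \<omega> (h i)) - F \<omega>\<bar> \<le> C"
  shows "(\<integral>\<omega>. F (\<lambda>i. \<omega> (h i)) - F \<omega> \<partial>coins) = 0"
proof -
  note [measurable] = measurable_recode[of h "\<lambda>_. True", simplified]
  define tr where "tr K v = max (- real K) (min (real K) v)" for K v
  have [measurable]: "tr K \<in> borel_measurable borel" for K
    unfolding tr_def by measurable
  have lipschitz: "\<bar>tr K u - tr K v\<bar> \<le> \<bar>u - v\<bar>" for K u v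
    by (auto simp: tr_def max_def min_def abs_real_def)
  have tr_bound: "\<bar>tr K v\<bar> \<le> real K" for K v by (auto simp: tr_def)
  have int: "integrable coins (\<lambda>\<omega>. tr K (G \<omega>))" if [measurable]: "G \<in> borel_measurable coins" for G K
    by (rule coins.integrable_const_bound[where B="real K"]) (auto simp: tr_bound)
  have zero: "(\<integral>\<omega>. tr K (F (\<lambda>i. \<omega> (h i))) - tr K (F \<omega>) \<partial>coins) = 0" for K
    using integral_recode[OF inj, of "\<lambda>\<omega>. tr K (F \<omega>)" "\<lambda>_. True"]
    by (subst Bochner_Integration.integral_diff) (auto intro!: int)
  have "(\<lambda>K. \<integral>\<omega>. tr K (F (\<lambda>i. \<omega> (h i))) - tr K (F \<omega>) \<partial>coins)
      \<longlonglongrightarrow> (\<integral>\<omega>. F (\<lambda>i. \<omega> (h i)) - F \<omega> \<partial>coins)"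
  proof (rule integral_dominated_convergence[where w="\<lambda>_. C"])
    have lim: "(\<lambda>K. tr K v) \<longlonglongrightarrow> v" for v
    proof (rule tendsto_eventually)
      obtain K0 :: nat where "\<bar>v\<bar> \<le> real K0" using real_arch_simple by blast
      then have "\<forall>K\<ge>K0. tr K v = v" by (auto simp: tr_def)
      then show "eventually (\<lambda>K. tr K v = v) sequentially"
        by (auto simp: eventually_sequentially)
    qed
    then show "AE \<omega> in coins. (\<lambda>K. tr K (F (\<lambda>i. \<omega> (h i))) - tr K (F \<omega>)) \<longlonglongrightarrow> F (\<lambda>i. \<omega> (h i)) - F \<omega>"
      by (intro AE_I2 tendsto_diff)
    fix K
    show "AE \<omega> in coins. norm (tr K (F (\<lambda>i. \<omega> (h i))) - tr K (F \<omega>)) \<le> C"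
      using bound unfolding real_norm_def by eventually_elim (rule order_trans[OF lipschitz])
  qed auto
  then show ?thesis by (simp add: zero LIMSEQ_const_iff)
qed

section \<open>The half plane above a recurrent line\<close>

text \<open>The \<open>m\<close> departures that match \<open>m\<close> visits use coins 0 to
  \<open>m - 1\<close>, and coin 0 is spent on the vertical one; hence the range
  \<open>{1..<m}\<close>.\<close>

definition rights :: "(int \<times> nat \<times> nat \<Rightarrow> bool) \<Rightarrow> int \<Rightarrow> nat \<Rightarrow> nat \<Rightarrow> nat" where
  "rights \<omega> x j m = card {k\<in>{1..<m}. \<omega> (x, j, k)}"

definition lefts :: "(int \<times> nat \<times> nat \<Rightarrow> bool) \<Rightarrow> int \<Rightarrow> nat \<Rightarrow> nat \<Rightarrow> nat" where
  "lefts \<omega> x j m = card {k\<in>{1..<m}. \<not> \<omega> (x, j, k)}"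

text \<open>Height \<open>j\<close> is a natural number. Coin 0 of a site decides between up (\<open>True\<close>) and down for its
  first departure, the later coins between right (\<open>True\<close>) and left. The sites of line 0 have exactly
  one visit, hence only their vertical departure.\<close>

primrec visits :: "(int \<times> nat \<times> nat \<Rightarrow> bool) \<Rightarrow> nat \<Rightarrow> int \<Rightarrow> nat \<Rightarrow> nat" where
  "visits \<omega> 0 = (\<lambda>x j. if j = 0 then 1 else 0)"
| "visits \<omega> (Suc n) = (\<lambda>x j. if j = 0 then 1 else
      of_bool (0 < visits \<omega> n x (j - 1) \<and> \<omega> (x, j - 1, 0)) +
      of_bool (0 < visits \<omega> n x (j + 1) \<and> \<not> \<omega> (x, j + 1, 0)) +
      rights \<omega> (x - 1) j (visits \<omega> n (x - 1) j) + lefts \<omega> (x + 1) j (visits \<omega> n (x + 1) j))"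

definition visited :: "(int \<times> nat \<times> nat \<Rightarrow> bool) \<Rightarrow> int \<Rightarrow> nat \<Rightarrow> bool" where
  "visited \<omega> x j \<longleftrightarrow> (\<exists>n. 0 < visits \<omega> n x j)"

text \<open>Finiteness of the least solution, the increasing limit of the iterates, is stated as a
  bound on them so that no infinite value occurs.\<close>

definition transient :: "(int \<times> nat \<times> nat \<Rightarrow> bool) \<Rightarrow> int \<Rightarrow> nat \<Rightarrow> bool" where
  "transient \<omega> x j \<longleftrightarrow> (\<exists>K. \<forall>n. visits \<omega> n x j \<le> K)"

text \<open>Net number of rightward crossings of the edge between \<open>x\<close> and
  \<open>x + 1\<close>. At transient sites the sequence is eventually constant and
  \<open>lim\<close> is its final value; \<open>flow_balance\<close> uses it only there.\<close>

definition flow :: "(int \<times> nat \<times> nat \<Rightarrow> bool) \<Rightarrow> int \<Rightarrow> nat \<Rightarrow> real" where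
  "flow \<omega> x j = lim (\<lambda>n. real (rights \<omega> x j (visits \<omega> n x j)) -
    real (lefts \<omega> (x + 1) j (visits \<omega> n (x + 1) j)))"

lemma rights_0 [simp]: "rights \<omega> x j 0 = 0" and lefts_0 [simp]: "lefts \<omega> x j 0 = 0"
  by (simp_all add: rights_def lefts_def)

lemma rights_mono: "m \<le> m' \<Longrightarrow> rights \<omega> x j m \<le> rights \<omega> x j m'"
  unfolding rights_def by (intro card_mono) auto

lemma lefts_mono: "m \<le> m' \<Longrightarrow> lefts \<omega> x j m \<le> lefts \<omega> x j m'"
  unfolding lefts_def by (intro card_mono) auto

lemma rights_plus_lefts: "of_bool (0 < m) + rights \<omega> x j m + lefts \<omega> x j m = m"
proof -
  have "card {1..<m} = card ({k\<in>{1..<m}. \<omega> (x, j, k)} \<union> {k\<in>{1..<m}. \<not> \<omega> (x, j, k)})"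
    by (rule arg_cong[where f=card]) auto
  also have "\<dots> = rights \<omega> x j m + lefts \<omega> x j m"
    unfolding rights_def lefts_def by (rule card_Un_disjoint) auto
  finally have "card {1..<m} = rights \<omega> x j m + lefts \<omega> x j m" .
  then show ?thesis by (cases m) auto
qed

lemma visits_0_line [simp]: "visits \<omega> n x 0 = 1"
  by (cases n) auto

text \<open>Each term of the recursion is monotone in the previous counts, and the initial
  configuration lies below its image.\<close>

lemma visits_Suc_mono: "visits \<omega> n x j \<le> visits \<omega> (Suc n) x j"
proof (induction n arbitrary: x j)
  case 0
  show ?case by simp
next
  case (Suc n)
  have "of_bool (0 < visits \<omega> n x' j' \<and> c) \<le> (of_bool (0 < visits \<omega> (Suc n) x' j' \<and> c) :: nat)" for x' j' c
    using Suc.IH[of x' j'] by (auto simp del: visits.simps)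
  moreover note Suc.IH
  ultimately show ?case
    unfolding visits.simps(2)[of \<omega> "Suc n"] visits.simps(2)[of \<omega> n, THEN fun_cong, THEN fun_cong, of x j]
    by (cases "j = 0") (simp_all del: visits.simps add: add_mono rights_mono lefts_mono)
qed

lemma mono_visits: "mono (\<lambda>n. visits \<omega> n x j)"
  unfolding mono_iff_le_Suc using visits_Suc_mono by blast

lemma eventually_visited:
  "eventually (\<lambda>n. 0 < visits \<omega> n x j \<longleftrightarrow> visited \<omega> x j) sequentially"
proof (cases "visited \<omega> x j")
  case True
  then obtain n0 where "0 < visits \<omega> n0 x j" by (auto simp: visited_def)
  then have "\<forall>n\<ge>n0. 0 < visits \<omega> n x j"
    using monoD[OF mono_visits] by (meson order_less_le_trans)
  then show ?thesis using True by (auto simp: eventually_sequentially)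
qed (auto simp: visited_def)

lemma transient_eventually_const:
  assumes "transient \<omega> x j"
  obtains c where "eventually (\<lambda>n. visits \<omega> n x j = c) sequentially"
proof -
  let ?S = "range (\<lambda>n. visits \<omega> n x j)"
  have fin: "finite ?S"
    using assms by (auto simp: transient_def finite_nat_set_iff_bounded_le)
  then have "Max ?S \<in> ?S" by (intro Max_in) auto
  then obtain n0 where n0: "visits \<omega> n0 x j = Max ?S" by auto
  have "visits \<omega> n x j = Max ?S" if "n \<ge> n0" for n
    using monoD[OF mono_visits that, of \<omega> x j] n0 fin
    by (intro order_antisym Max_ge) auto
  then show ?thesis using that by (auto simp: eventually_sequentially)
qed

lemma not_transient_visited: "\<not> transient \<omega> x j \<Longrightarrow> visited \<omega> x j"
  unfolding transient_def visited_def by (metis gr0I le_refl)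

lemma visited_0 [simp]: "visited \<omega> x 0"
  by (simp add: visited_def)

text \<open>At a transient site the final count equals the arrivals, by the recursion, and the
  departures, by \<open>rights_plus_lefts\<close>. In the difference the horizontal terms combine
  into two edge flows, leaving vertical arrivals minus the one vertical departure.\<close>

lemma flow_balance:
  assumes "transient \<omega> (x - 1) j" "transient \<omega> x j" "transient \<omega> (x + 1) j" "0 < j"
  shows "of_bool (visited \<omega> x (j - 1) \<and> \<omega> (x, j - 1, 0)) +
      of_bool (visited \<omega> x (j + 1) \<and> \<not> \<omega> (x, j + 1, 0)) - of_bool (visited \<omega> x j) =
    flow \<omega> x j - flow \<omega> (x - 1) j"
proof -
  obtain a where a: "eventually (\<lambda>n. visits \<omega> n (x - 1) j = a) sequentially"
    by (rule transient_eventually_const[OF assms(1)])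
  obtain b where b: "eventually (\<lambda>n. visits \<omega> n x j = b) sequentially"
    by (rule transient_eventually_const[OF assms(2)])
  obtain c where c: "eventually (\<lambda>n. visits \<omega> n (x + 1) j = c) sequentially"
    by (rule transient_eventually_const[OF assms(3)])
  have "flow \<omega> x j = real (rights \<omega> x j b) - real (lefts \<omega> (x + 1) j c)"
    unfolding flow_def using b c
    by (intro limI tendsto_eventually) (auto elim: eventually_elim2)
  moreover have "flow \<omega> (x - 1) j = real (rights \<omega> (x - 1) j a) - real (lefts \<omega> x j b)"
    unfolding flow_def using a b
    by (intro limI tendsto_eventually) (auto elim: eventually_elim2)
  moreover
  \<comment> \<open>Iterate \<open>n + 1\<close> is computed from iterate \<open>n\<close>, so the
    constancy at \<open>x\<close> is used one step later than at its neighbours.\<close>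
  have "eventually (\<lambda>n. b = of_bool (visited \<omega> x (j - 1) \<and> \<omega> (x, j - 1, 0)) +
      of_bool (visited \<omega> x (j + 1) \<and> \<not> \<omega> (x, j + 1, 0)) + rights \<omega> (x - 1) j a + lefts \<omega> (x + 1) j c)
      sequentially"
    using a c eventually_visited[of \<omega> x "j - 1"] eventually_visited[of \<omega> x "j + 1"]
      b[THEN sequentially_offset[where k=1]]
    by eventually_elim (use \<open>0 < j\<close> in \<open>simp\<close>)
  then have "b = of_bool (visited \<omega> x (j - 1) \<and> \<omega> (x, j - 1, 0)) +
      of_bool (visited \<omega> x (j + 1) \<and> \<not> \<omega> (x, j + 1, 0)) + rights \<omega> (x - 1) j a + lefts \<omega> (x + 1) j c"
    by simp
  moreover have "eventually (\<lambda>n. 0 < b \<longleftrightarrow> visited \<omega> x j) sequentially"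
    using b eventually_visited[of \<omega> x j] by eventually_elim simp
  then have "b = of_bool (visited \<omega> x j) + rights \<omega> x j b + lefts \<omega> x j b"
    using rights_plus_lefts[of b \<omega> x j] by simp
  ultimately show ?thesis
    by (smt (verit) of_nat_add of_nat_of_bool)
qed

text \<open>A site that is never visited makes no departures, so none of its coins is ever
  read.\<close>

lemma visits_cong_unvisited:
  assumes "\<not> visited \<omega> x j" "0 < j" "\<And>x' j' k. (x', j') \<noteq> (x, j) \<Longrightarrow> \<omega>' (x', j', k) = \<omega> (x', j', k)"
  shows "visits \<omega>' n x' j' = visits \<omega> n x' j'"
proof (induction n arbitrary: x' j')
  case 0
  show ?case by simp
next
  case (Suc n)
  have zero: "visits \<omega> n x j = 0" using assms(1) by (auto simp: visited_def)
  have "rights \<omega>' x'' j'' (visits \<omega> n x'' j'') = rights \<omega> x'' j'' (visits \<omega> n x'' j'')" for x'' j''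
    using assms(3) by (cases "(x'', j'') = (x, j)") (auto simp: zero rights_def)
  moreover have "lefts \<omega>' x'' j'' (visits \<omega> n x'' j'') = lefts \<omega> x'' j'' (visits \<omega> n x'' j'')" for x'' j''
    using assms(3) by (cases "(x'', j'') = (x, j)") (auto simp: zero lefts_def)
  moreover have "0 < visits \<omega> n x'' j'' \<and> \<omega>' (x'', j'', 0) \<longleftrightarrow> 0 < visits \<omega> n x'' j'' \<and> \<omega> (x'', j'', 0)"
    "0 < visits \<omega> n x'' j'' \<and> \<not> \<omega>' (x'', j'', 0) \<longleftrightarrow> 0 < visits \<omega> n x'' j'' \<and> \<not> \<omega> (x'', j'', 0)" for x'' j''
    using assms(3) by (cases "(x'', j'') = (x, j)"; auto simp: zero)+
  ultimately show ?case by (simp only: visits.simps Suc.IH)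
qed

text \<open>The coins of a site matter only after its first visit. This is what makes its first coin
  independent of whether it is visited.\<close>

lemma visited_cong:
  assumes "\<And>x' j' k. (x', j') \<noteq> (x, j) \<Longrightarrow> \<omega>' (x', j', k) = \<omega> (x', j', k)"
  shows "visited \<omega>' x j \<longleftrightarrow> visited \<omega> x j"
proof (cases "j = 0")
  case False
  then show ?thesis
    using visits_cong_unvisited[of \<omega> x j \<omega>'] visits_cong_unvisited[of \<omega>' x j \<omega>] assms
    unfolding visited_def by (metis neq0_conv)
qed simp

section \<open>Equivariance under horizontal translations\<close>

definition translate :: "int \<Rightarrow> int \<times> nat \<times> nat \<Rightarrow> int \<times> nat \<times> nat" where
  "translate a = (\<lambda>(x, j, k). (x + a, j, k))"

lemma translate_simp [simp]: "translate a (x, j, k) = (x + a, j, k)"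
  by (simp add: translate_def)

lemma visits_shift:
  "visits (\<lambda>i. \<omega> (translate a i)) n x j = visits \<omega> n (x + a) j"
proof (induction n arbitrary: x j)
  case (Suc n)
  have "rights (\<lambda>i. \<omega> (translate a i)) x j m = rights \<omega> (x + a) j m"
    "lefts (\<lambda>i. \<omega> (translate a i)) x j m = lefts \<omega> (x + a) j m" for x j m
    by (simp_all add: rights_def lefts_def)
  moreover have "x - 1 + a = x + a - 1" "x + 1 + a = x + a + 1" by simp_all
  ultimately show ?case by (simp only: visits.simps Suc.IH translate_simp)
qed simp

lemma visited_shift: "visited (\<lambda>i. \<omega> (translate a i)) x j \<longleftrightarrow> visited \<omega> (x + a) j"
  by (simp add: visited_def visits_shift)

lemma transient_shift: "transient (\<lambda>i. \<omega> (translate a i)) x j \<longleftrightarrow> transient \<omega> (x + a) j"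
  by (simp add: transient_def visits_shift)

lemma flow_shift: "flow (\<lambda>i. \<omega> (translate a i)) x j = flow \<omega> (x + a) j"
  by (simp add: flow_def visits_shift rights_def lefts_def add.assoc add.commute[of 1 a])

lemma inj_translate: "inj (translate a)"
  by (auto simp: inj_def translate_def)

lemma unbounded_card_below:
  fixes P :: "nat \<Rightarrow> bool"
  assumes "\<exists>\<^sub>\<infinity>k. P k"
  shows "\<exists>m. K \<le> card {k\<in>{1..<m}. P k}"
proof -
  have "infinite {k. P k}" using assms by (simp add: INFM_iff_infinite)
  then have "infinite ({k. P k} - {0})" by simp
  from infinite_arbitrarily_large[OF this, of K]
  obtain A where A: "finite A" "card A = K" "A \<subseteq> {k. P k} - {0}" by blast
  have "A \<subseteq> {k\<in>{1..<Suc (Max A)}. P k}"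
  proof
    fix k assume "k \<in> A"
    then have "k \<le> Max A" "P k" "k \<noteq> 0" using A by auto
    then show "k \<in> {k\<in>{1..<Suc (Max A)}. P k}" by simp
  qed
  then have "card A \<le> card {k\<in>{1..<Suc (Max A)}. P k}" by (intro card_mono) auto
  then show ?thesis using A(2) by blast
qed

text \<open>Unbounded visits to \<open>x\<close> read its whole stack, hence infinitely many coins
  in each direction, and the arrivals exceed the bound \<open>K\<close> at the neighbour.\<close>

lemma transient_neighbour:
  assumes "transient \<omega> x' j" "x' = x + 1 \<or> x' = x - 1" "0 < j"
    "\<And>b. \<exists>\<^sub>\<infinity>k. \<omega> (x, j, k) = b"
  shows "transient \<omega> x j"
proof (rule ccontr)
  assume "\<not> transient \<omega> x j"
  then have unbounded: "\<exists>n. m \<le> visits \<omega> n x j" for m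
    unfolding transient_def by (meson nle_le)
  obtain K where K: "\<And>n. visits \<omega> n x' j \<le> K" using assms(1) by (auto simp: transient_def)
  from assms(2) show False
  proof
    assume x': "x' = x + 1"
    obtain m where "K + 1 \<le> rights \<omega> x j m"
      using unbounded_card_below[of "\<lambda>k. \<omega> (x, j, k)" "K + 1"] assms(4)[of True]
      by (auto simp: rights_def)
    moreover obtain n where "m \<le> visits \<omega> n x j" using unbounded by blast
    ultimately have "K + 1 \<le> rights \<omega> x j (visits \<omega> n x j)"
      using rights_mono order_trans by blast
    also have "\<dots> \<le> visits \<omega> (Suc n) x' j" using x' \<open>0 < j\<close> by simp
    finally show False using K[of "Suc n"] by simp
  next
    assume x': "x' = x - 1"
    obtain m where "K + 1 \<le> lefts \<omega> x j m"
      using unbounded_card_below[of "\<lambda>k. \<not> \<omega> (x, j, k)" "K + 1"] assms(4)[of False]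
      by (auto simp: lefts_def)
    moreover obtain n where "m \<le> visits \<omega> n x j" using unbounded by blast
    ultimately have "K + 1 \<le> lefts \<omega> x j (visits \<omega> n x j)"
      using lefts_mono order_trans by blast
    also have "\<dots> \<le> visits \<omega> (Suc n) x' j" using x' \<open>0 < j\<close> by simp
    finally show False using K[of "Suc n"] by simp
  qed
qed

lemma transient_line:
  assumes "transient \<omega> x0 j" "0 < j" "\<And>x b. \<exists>\<^sub>\<infinity>k. \<omega> (x, j, k) = b"
  shows "transient \<omega> x j"
proof (induction x rule: int_induct[where k=x0])
  case base
  show ?case by fact
next
  case (step1 i)
  then show ?case using transient_neighbour[of \<omega> i j "i + 1"] assms by auto
next
  case (step2 i)
  then show ?case using transient_neighbour[of \<omega> i j "i - 1"] assms by auto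
qed

section \<open>The line next to a recurrent line\<close>

lemma measurable_rights [measurable]: "(\<lambda>\<omega>. rights \<omega> x j m) \<in> measurable coins (count_space UNIV)"
  unfolding rights_def by measurable

lemma measurable_lefts [measurable]: "(\<lambda>\<omega>. lefts \<omega> x j m) \<in> measurable coins (count_space UNIV)"
  unfolding lefts_def by measurable

lemma measurable_plus_nat:
  fixes f g :: "'a \<Rightarrow> nat"
  assumes f: "f \<in> measurable M (count_space UNIV)" and g: "g \<in> measurable M (count_space UNIV)"
  shows "(\<lambda>x. f x + g x) \<in> measurable M (count_space UNIV)"
  by (rule measurable_compose_countable[OF _ f], rule measurable_compose[OF g]) simp

lemma measurable_of_bool:
  assumes "Measurable.pred M P"
  shows "(\<lambda>x. of_bool (P x) :: nat) \<in> measurable M (count_space UNIV)"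
  using assms by (rule measurable_compose) simp

lemma measurable_visits [measurable]: "(\<lambda>\<omega>. visits \<omega> n x j) \<in> measurable coins (count_space UNIV)"
proof (induction n arbitrary: x j)
  case (Suc n)
  note [measurable] = Suc.IH
  have [measurable]: "(\<lambda>\<omega>. rights \<omega> x j (visits \<omega> n x j)) \<in> measurable coins (count_space UNIV)"
    "(\<lambda>\<omega>. lefts \<omega> x j (visits \<omega> n x j)) \<in> measurable coins (count_space UNIV)" for x j
    by (rule measurable_compose_countable[OF _ Suc.IH], measurable)+
  show ?case
  proof (cases "j = 0")
    case False
    have "Measurable.pred coins (\<lambda>\<omega>. 0 < visits \<omega> n x (j - 1) \<and> \<omega> (x, j - 1, 0))"
      "Measurable.pred coins (\<lambda>\<omega>. 0 < visits \<omega> n x (j + 1) \<and> \<not> \<omega> (x, j + 1, 0))"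
      by measurable
    with False show ?thesis
      unfolding visits.simps by (simp only: if_False)
        (intro measurable_plus_nat measurable_of_bool; measurable)
  qed simp
qed simp

lemma measurable_rights_visits [measurable]:
  "(\<lambda>\<omega>. rights \<omega> x j (visits \<omega> n x j)) \<in> measurable coins (count_space UNIV)"
  "(\<lambda>\<omega>. lefts \<omega> x j (visits \<omega> n x j)) \<in> measurable coins (count_space UNIV)"
  by (rule measurable_compose_countable[OF _ measurable_visits], measurable)+

lemma measurable_visited [measurable]: "Measurable.pred coins (\<lambda>\<omega>. visited \<omega> x j)"
  unfolding visited_def by measurable

lemma measurable_transient [measurable]: "Measurable.pred coins (\<lambda>\<omega>. transient \<omega> x j)"
  unfolding transient_def by measurable

lemma measurable_flow [measurable]: "(\<lambda>\<omega>. flow \<omega> x j) \<in> borel_measurable coins"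
  unfolding flow_def
proof (rule borel_measurable_lim_metric)
  fix n
  have "real \<in> measurable (count_space UNIV) borel" by simp
  note [measurable] = measurable_compose[OF measurable_rights_visits(1) this]
    measurable_compose[OF measurable_rights_visits(2) this]
  show "(\<lambda>\<omega>. real (rights \<omega> x j (visits \<omega> n x j)) -
      real (lefts \<omega> (x + 1) j (visits \<omega> n (x + 1) j))) \<in> borel_measurable coins"
    by measurable
qed

lemma sets_coins_Collect: "Measurable.pred coins P \<Longrightarrow> {\<omega>. P \<omega>} \<in> sets coins"
  by (drule predE) simp

lemma AE_infinitely_often_each_direction:
  "AE \<omega> in coins. \<forall>x j b. \<exists>\<^sub>\<infinity>k. \<omega> (x :: int, j :: nat, k :: nat) = b"
  unfolding AE_all_countable by (intro allI AE_coins_infinitely_often) (auto simp: inj_def)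

text \<open>Transience of the whole line is a translation invariant event, so its probability is 0
  or 1. If it is 0, almost surely some site fails to be transient, and then by
  \<open>transient_line\<close> every site fails.\<close>

lemma transient_line_zero_one:
  assumes "0 < j"
  shows "(AE \<omega> in coins. \<forall>x. transient \<omega> x j) \<or> (AE \<omega> in coins. \<forall>x. \<not> transient \<omega> x j)"
proof -
  let ?A = "{\<omega>. \<forall>x. transient \<omega> x j}"
  have A: "?A \<in> sets coins" by (rule sets_coins_Collect) measurable
  have "measure coins ?A = 0 \<or> measure coins ?A = 1"
  proof (rule coins_invariant_zero_one[where h="\<lambda>n. translate (int n)"])
    fix n \<omega>
    have "(\<forall>x. transient \<omega> (x + int n) j) \<longleftrightarrow> (\<forall>x. transient \<omega> x j)"
      by (metis diff_add_cancel)
    then show "(\<lambda>i. \<omega> (translate (int n) i)) \<in> ?A \<longleftrightarrow> \<omega> \<in> ?A"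
      by (simp add: transient_shift)
  next
    fix i i' :: "int \<times> nat \<times> nat"
    obtain x j k x' j' k' where i: "i = (x, j, k)" "i' = (x', j', k')" by (metis prod_cases3)
    have "\<forall>n\<ge>nat (x' - x + 1). translate (int n) i \<noteq> i'" by (auto simp: i)
    then show "eventually (\<lambda>n. translate (int n) i \<noteq> i') sequentially"
      by (auto simp: eventually_sequentially)
  qed (use A inj_translate in auto)
  then show ?thesis
  proof
    assume "measure coins ?A = 1"
    then show ?thesis using coins.prob_Collect_eq_1[of "\<lambda>\<omega>. \<forall>x. transient \<omega> x j"] A by simp
  next
    assume "measure coins ?A = 0"
    then have "AE \<omega> in coins. \<not> (\<forall>x. transient \<omega> x j)"
      using coins.prob_Collect_eq_0[of "\<lambda>\<omega>. \<forall>x. transient \<omega> x j"] A by simp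
    then have "AE \<omega> in coins. \<forall>x. \<not> transient \<omega> x j"
      using AE_infinitely_often_each_direction
    proof eventually_elim
      case (elim \<omega>)
      then show ?case using transient_line[OF _ \<open>0 < j\<close>, of \<omega>] by blast
    qed
    then show ?thesis ..
  qed
qed

section \<open>The probability of being visited as a function of the height\<close>

definition visit_prob :: "nat \<Rightarrow> real" where
  "visit_prob j = measure coins {\<omega>. visited \<omega> 0 j}"

lemma visit_prob_0 [simp]: "visit_prob 0 = 1"
  using coins.prob_space by (simp add: visit_prob_def)

lemma prob_visited: "measure coins {\<omega>. visited \<omega> x j} = visit_prob j"
  using prob_recode[OF inj_translate sets_coins_Collect[OF measurable_visited], of x "\<lambda>_. True" 0 j]
  by (simp add: visit_prob_def visited_shift)

text \<open>Flipping coin \<open>i\<close> preserves the measure and the event \<open>A\<close> and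
  swaps the two halves of \<open>A\<close>. This gives the fairness of a coin not yet read, both at
  a first visit and for the next step of the walk.\<close>

lemma prob_coin_flip_invariant:
  assumes A: "A \<in> sets coins"
    and invariant: "\<And>\<omega> \<omega>'. (\<And>i'. i' \<noteq> i \<Longrightarrow> \<omega>' i' = \<omega> i') \<Longrightarrow> \<omega> \<in> A \<Longrightarrow> \<omega>' \<in> A"
  shows "measure coins {\<omega>\<in>A. \<omega> i = b} = measure coins A / 2"
proof -
  let ?A = "\<lambda>b. {\<omega>\<in>A. \<omega> i = b}"
  have sets_A: "?A b \<in> sets coins" for b
  proof -
    have "A \<inter> {\<omega>. \<omega> i = b} \<in> sets coins"
      by (rule sets.Int[OF A sets_coins_Collect]) measurable
    then show ?thesis by (simp add: Int_def)
  qed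
  let ?flip = "\<lambda>\<omega> i'. \<omega> (id i') = (i' \<noteq> i)"
  have "?flip \<omega> \<in> A \<longleftrightarrow> \<omega> \<in> A" for \<omega>
    using invariant[of "?flip \<omega>" \<omega>] invariant[of \<omega> "?flip \<omega>"] by auto
  then have "{\<omega>. ?flip \<omega> \<in> ?A b} = ?A (\<not> b)" by auto
  with prob_recode[OF inj_on_id sets_A, of "\<lambda>i'. i' \<noteq> i" b]
  have "measure coins (?A (\<not> b)) = measure coins (?A b)" by simp
  moreover have "measure coins (?A b) + measure coins (?A (\<not> b)) = measure coins (?A b \<union> ?A (\<not> b))"
    by (rule coins.finite_measure_Union[symmetric, OF sets_A sets_A]) auto
  moreover have "?A b \<union> ?A (\<not> b) = A" by auto
  ultimately show ?thesis by simp
qed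

lemma visited_indep_first_coin:
  "measure coins {\<omega>. visited \<omega> x j \<and> \<omega> (x, j, 0) = b} = visit_prob j / 2"
proof -
  have "measure coins {\<omega>\<in>{\<omega>. visited \<omega> x j}. \<omega> (x, j, 0) = b} = measure coins {\<omega>. visited \<omega> x j} / 2"
  proof (rule prob_coin_flip_invariant[OF sets_coins_Collect[OF measurable_visited]])
    fix \<omega> \<omega>' :: "int \<times> nat \<times> nat \<Rightarrow> bool"
    assume agree: "\<And>i'. i' \<noteq> (x, j, 0) \<Longrightarrow> \<omega>' i' = \<omega> i'" and vis: "\<omega> \<in> {\<omega>. visited \<omega> x j}"
    have "visited \<omega>' x j \<longleftrightarrow> visited \<omega> x j"
      by (rule visited_cong, rule agree) auto
    with vis show "\<omega>' \<in> {\<omega>. visited \<omega> x j}" by simp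
  qed
  then show ?thesis by (simp add: prob_visited)
qed

text \<open>This is the mean of \<open>flow_balance\<close> at column 0: the flow difference is a
  coboundary of the translation by 1 and has mean 0, and each vertical neighbour, if visited, sends
  its particle here with probability one half.\<close>

lemma visit_prob_harmonic:
  assumes "0 < j" "AE \<omega> in coins. \<forall>x. transient \<omega> x j"
  shows "visit_prob (j - 1) / 2 + visit_prob (j + 1) / 2 = visit_prob j"
proof -
  let ?g = "\<lambda>\<omega>. of_bool (visited \<omega> 0 (j - 1) \<and> \<omega> (0, j - 1, 0)) +
      of_bool (visited \<omega> 0 (j + 1) \<and> \<not> \<omega> (0, j + 1, 0)) - of_bool (visited \<omega> 0 j) :: real"
  have balance: "AE \<omega> in coins. flow (\<lambda>i. \<omega> (translate 1 i)) (- 1) j - flow \<omega> (- 1) j = ?g \<omega>"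
    using assms(2)
  proof eventually_elim
    case (elim \<omega>)
    then show ?case using flow_balance[of \<omega> 0 j] \<open>0 < j\<close> by (simp add: flow_shift)
  qed
  have "(\<integral>\<omega>. flow (\<lambda>i. \<omega> (translate 1 i)) (- 1) j - flow \<omega> (- 1) j \<partial>coins) = 0"
  proof (rule coins_coboundary_integral_zero[OF inj_translate])
    \<comment> \<open>The balance \<open>?g\<close> lies between -1 and 2.\<close>
    show "AE \<omega> in coins. \<bar>flow (\<lambda>i. \<omega> (translate 1 i)) (- 1) j - flow \<omega> (- 1) j\<bar> \<le> 2"
      using balance by eventually_elim (simp add: of_bool_def)
  qed simp
  also have "(\<integral>\<omega>. flow (\<lambda>i. \<omega> (translate 1 i)) (- 1) j - flow \<omega> (- 1) j \<partial>coins) = (\<integral>\<omega>. ?g \<omega> \<partial>coins)"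
    by (rule integral_cong_AE) (use balance in \<open>simp_all add: flow_shift\<close>)
  also have "\<dots> = measure coins {\<omega>. visited \<omega> 0 (j - 1) \<and> \<omega> (0, j - 1, 0) = True} +
    measure coins {\<omega>. visited \<omega> 0 (j + 1) \<and> \<omega> (0, j + 1, 0) = False} - measure coins {\<omega>. visited \<omega> 0 j}"
  proof -
    have int: "integrable coins (\<lambda>\<omega>. of_bool (P \<omega>) :: real)" and
      val: "(\<integral>\<omega>. of_bool (P \<omega>) \<partial>coins) = measure coins {\<omega>. P \<omega>}"
      if [measurable]: "Measurable.pred coins P" for P :: "(int \<times> nat \<times> nat \<Rightarrow> bool) \<Rightarrow> bool"
    proof -
      have "(\<lambda>\<omega>. of_bool (P \<omega>)) = (indicator {\<omega>. P \<omega>} :: _ \<Rightarrow> real)"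
        by (auto simp: fun_eq_iff indicator_def)
      then show "integrable coins (\<lambda>\<omega>. of_bool (P \<omega>) :: real)"
        "(\<integral>\<omega>. of_bool (P \<omega>) \<partial>coins) = measure coins {\<omega>. P \<omega>}"
        using sets_coins_Collect[OF that] by (simp_all add: coins.emeasure_eq_measure)
    qed
    show ?thesis by (simp add: int val)
  qed
  finally show ?thesis by (simp only: visited_indep_first_coin prob_visited)
qed

text \<open>The probability of not visiting a site is harmonic in the height as long as the lines are
  transient and vanishes on the other lines and at height 0; being bounded, it vanishes.\<close>

lemma visit_prob_eq_1:
  assumes "AE \<omega> in coins. \<forall>x. transient \<omega> x 1"
  shows "visit_prob 1 = 1" "visit_prob 2 = 1"
proof -
  define d where "d j = 1 - visit_prob j" for j
  have d_bounds: "0 \<le> d j" "d j \<le> 1" for j by (simp_all add: d_def visit_prob_def)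
  have dich: "d j = 0 \<or> 2 * d j = d (j - 1) + d (j + 1)" if "0 < j" for j
    using transient_line_zero_one[OF that]
  proof
    assume "AE \<omega> in coins. \<forall>x. transient \<omega> x j"
    from visit_prob_harmonic[OF that this] show ?thesis by (simp add: d_def)
  next
    assume "AE \<omega> in coins. \<forall>x. \<not> transient \<omega> x j"
    then have "AE \<omega> in coins. visited \<omega> 0 j"
      by eventually_elim (blast intro: not_transient_visited)
    then have "visit_prob j = 1"
      using coins.prob_Collect_eq_1[of "\<lambda>\<omega>. visited \<omega> 0 j"] sets_coins_Collect[OF measurable_visited]
      by (simp add: visit_prob_def)
    then show ?thesis by (simp add: d_def)
  qed
  have d0: "d 0 = 0" by (simp add: d_def)
  have d1: "d 1 = 0"
  proof (rule ccontr)
    assume "d 1 \<noteq> 0"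
    then have pos: "0 < d 1" using d_bounds(1)[of 1] by linarith
    \<comment> \<open>Starting from \<open>d 0 = 0\<close>, a positive \<open>d 1\<close> keeps each
      later \<open>d j\<close> nonzero, so the harmonic alternative always applies and
      \<open>d\<close> grows linearly, past the bound 1.\<close>
    have linear: "d j = real j * d 1 \<and> d (Suc j) = real (Suc j) * d 1" for j
    proof (induction j)
      case (Suc j)
      then have "d (Suc j) \<noteq> 0" using pos by simp
      with dich[of "Suc j"] Suc.IH show ?case by (simp add: algebra_simps)
    qed (simp add: d0)
    obtain n where "1 < real n * d 1" using pos reals_Archimedean3 by blast
    then show False using d_bounds(2)[of n] linear[of n] by linarith
  qed
  have "2 * d 1 = d 0 + d 2"
    using visit_prob_harmonic[OF _ assms] by (simp add: d_def numeral_2_eq_2)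
  then show "visit_prob 1 = 1" "visit_prob 2 = 1" using d0 d1 by (simp_all add: d_def)
qed

lemma AE_visited:
  assumes "visit_prob j = 1"
  shows "AE \<omega> in coins. \<forall>x. visited \<omega> x j"
  unfolding AE_all_countable
proof
  fix x
  show "AE \<omega> in coins. visited \<omega> x j"
    using assms coins.prob_Collect_eq_1[of "\<lambda>\<omega>. visited \<omega> x j"] sets_coins_Collect[OF measurable_visited]
    by (simp add: prob_visited)
qed

text \<open>A centred coin with values 1/2 and -1/2 has characteristic function
  \<open>cos (t / 2)\<close>, whatever the sign \<open>s i\<close>. Independence multiplies these
  factors, and the real part of \<open>cis\<close> is the cosine.\<close>

lemma expectation_cos_coin_sum:
  fixes s :: "'i \<Rightarrow> real"
  assumes "finite I" "\<And>i. i \<in> I \<Longrightarrow> \<bar>s i\<bar> = 1"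
  shows "(\<integral>\<omega>. cos (t * (\<Sum>i\<in>I. s i * (of_bool (\<omega> i) - 1 / 2))) \<partial>coins) = cos (t / 2) ^ card I"
proof -
  let ?Y = "\<lambda>i b. cis (t * (s i * (of_bool b - 1 / 2)))"
  have indep: "coins.indep_vars (\<lambda>_. borel) (\<lambda>i \<omega>. ?Y i (\<omega> i)) I"
    by (rule coins.indep_vars_compose2[OF indep_vars_coins]) simp
  have int: "integrable coins (\<lambda>\<omega>. ?Y i (\<omega> i))" for i
    by (rule coins.integrable_const_bound[where B=1]) auto
  have val: "(\<integral>\<omega>. ?Y i (\<omega> i) \<partial>coins) = of_real (cos (t / 2))" if "i \<in> I" for i
  proof -
    have "s i = 1 \<or> s i = - 1" using assms(2)[OF that] by linarith
    then show ?thesis by (subst integral_coin) (auto simp: complex_eq_iff)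
  qed
  have prod: "(\<Prod>i\<in>I. ?Y i (\<omega> i)) = cis (t * (\<Sum>i\<in>I. s i * (of_bool (\<omega> i) - 1 / 2)))" for \<omega>
    using assms(1) by (induction I) (simp_all add: cis_mult distrib_left)
  have "(\<integral>\<omega>. cis (t * (\<Sum>i\<in>I. s i * (of_bool (\<omega> i) - 1 / 2))) \<partial>coins) = of_real (cos (t / 2)) ^ card I"
    using coins.indep_vars_lebesgue_integral[OF assms(1) indep int] val by (simp add: prod)
  moreover have "integrable coins (\<lambda>\<omega>. cis (t * (\<Sum>i\<in>I. s i * (of_bool (\<omega> i) - 1 / 2))))"
    using coins.indep_vars_integrable[OF assms(1) indep int] by (simp add: prod)
  note integral_Re[OF this]
  ultimately show ?thesis by (simp flip: of_real_power)
qed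

text \<open>With z = exp(i a) - 1 and w = exp(i b) - 1 this is half of |z - w|^2 \<le> 2 |z|^2 + 2
  |w|^2; the square that is dropped is |z + w|^2.\<close>

lemma one_minus_cos_diff_le: "1 - cos (a - b) \<le> 2 * (1 - cos a) + 2 * (1 - cos (b :: real))"
proof -
  have "0 \<le> (cos a + cos b - 2)\<^sup>2 + (sin a + sin b)\<^sup>2" by simp
  also have "\<dots> = 2 * (3 + cos (a - b) - 2 * cos a - 2 * cos b)"
  proof -
    have "(cos a + cos b - 2)\<^sup>2 + (sin a + sin b)\<^sup>2 = (cos a * cos a + sin a * sin a) +
        (cos b * cos b + sin b * sin b) + 2 * cos (a - b) + 4 - 4 * cos a - 4 * cos b"
      by (simp add: power2_eq_square algebra_simps cos_diff del: sin_cos_squared_add3)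
    then show ?thesis unfolding sin_cos_squared_add3 by simp
  qed
  finally show ?thesis by simp
qed

text \<open>If line 1 were transient, then every site of lines 1 and 2 would be visited, and the flow
  through line 1 would be a stationary process whose increments are sums of independent centred
  coins: by the central limit effect it could not be tight.\<close>

lemma AE_line_1_not_transient: "AE \<omega> in coins. \<forall>x. \<not> transient \<omega> x 1"
proof (rule ccontr)
  assume "\<not> ?thesis"
  then have trans: "AE \<omega> in coins. \<forall>x. transient \<omega> x 1"
    using transient_line_zero_one[of 1] by auto
  note v = AE_visited[OF visit_prob_eq_1(1)[OF trans]] AE_visited[OF visit_prob_eq_1(2)[OF trans]]
  let ?I = "\<lambda>N. {1..int N} \<times> {0, 2 :: nat} \<times> {0 :: nat}"
  let ?s = "\<lambda>(x::int, j::nat, k::nat). if j = 0 then 1 else - 1 :: real"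
  let ?S = "\<lambda>N \<omega>. \<Sum>i\<in>?I N. ?s i * (of_bool (\<omega> i) - 1 / 2)"
  have S_Suc: "?S (Suc N) \<omega> = ?S N \<omega> + of_bool (\<omega> (int N + 1, 0, 0)) + of_bool (\<not> \<omega> (int N + 1, 2, 0)) - 1" for N \<omega>
  proof -
    have "?I (Suc N) = insert (int N + 1, 0, 0) (insert (int N + 1, 2, 0) (?I N))" by auto
    then show ?thesis by (simp only:) (simp add: of_bool_def)
  qed
  have sum: "AE \<omega> in coins. \<forall>N. flow \<omega> (int N) 1 - flow \<omega> 0 1 = ?S N \<omega>"
    using trans v
  proof eventually_elim
    case (elim \<omega>)
    show ?case
    proof
      fix N show "flow \<omega> (int N) 1 - flow \<omega> 0 1 = ?S N \<omega>"
      proof (induction N)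
        case (Suc N)
        have "of_bool (\<omega> (int N + 1, 0, 0)) + of_bool (\<not> \<omega> (int N + 1, 2, 0)) - 1 =
            flow \<omega> (int N + 1) 1 - flow \<omega> (int N) 1"
          using flow_balance[of \<omega> "int N + 1" 1] elim by (simp add: numeral_2_eq_2)
        with Suc.IH show ?case unfolding S_Suc by (simp add: algebra_simps)
      qed simp
    qed
  qed
  \<comment> \<open>One minus the real part of the characteristic function of the flow. It tends to
    0 as \<open>t\<close> does, for any real random variable; but letting \<open>N\<close> grow in
    \<open>bound\<close>, at fixed small \<open>t\<close>, keeps it at least 1/4. The factor 4 there
    is 2 + 2 from \<open>one_minus_cos_diff_le\<close>, as both flows have the same law.\<close>
  define G where "G t = (\<integral>\<omega>. 1 - cos (t * flow \<omega> 0 1) \<partial>coins)" for t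
  have int: "integrable coins (\<lambda>\<omega>. cos (f \<omega>))" if [measurable]: "f \<in> borel_measurable coins"
    for f :: "(int \<times> nat \<times> nat \<Rightarrow> bool) \<Rightarrow> real"
    by (rule coins.integrable_const_bound[where B=1]) auto
  have int_1: "integrable coins (\<lambda>\<omega>. 1 - cos (t * flow \<omega> x 1))" for t x
    by (rule Bochner_Integration.integrable_diff[OF _ int]) auto
  have G_shift: "(\<integral>\<omega>. 1 - cos (t * flow \<omega> x 1) \<partial>coins) = G t" for t x
    using integral_recode[OF inj_translate, of "\<lambda>\<omega>. 1 - cos (t * flow \<omega> 0 1)" x "\<lambda>_. True"]
    by (simp add: flow_shift G_def)
  have bound: "1 - cos (t / 2) ^ (2 * N) \<le> 4 * G t" for t N
  proof -
    have "1 - cos (t / 2) ^ (2 * N) = (\<integral>\<omega>. 1 - cos (t * ?S N \<omega>) \<partial>coins)"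
    proof -
      have "(\<integral>\<omega>. cos (t * ?S N \<omega>) \<partial>coins) = cos (t / 2) ^ card (?I N)"
        by (rule expectation_cos_coin_sum) auto
      moreover have "card (?I N) = 2 * N" by (simp add: card_cartesian_product)
      moreover have "integrable coins (\<lambda>\<omega>. cos (t * ?S N \<omega>))"
        by (rule int) measurable
      ultimately show ?thesis
        using coins.prob_space by (simp add: mult_2)
    qed
    also have "\<dots> \<le> (\<integral>\<omega>. 2 * (1 - cos (t * flow \<omega> (int N) 1)) + 2 * (1 - cos (t * flow \<omega> 0 1)) \<partial>coins)"
    proof (rule integral_mono_AE)
      show "AE \<omega> in coins. 1 - cos (t * ?S N \<omega>) \<le>
          2 * (1 - cos (t * flow \<omega> (int N) 1)) + 2 * (1 - cos (t * flow \<omega> 0 1))"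
        using sum
      proof eventually_elim
        case (elim \<omega>)
        then have "t * ?S N \<omega> = t * flow \<omega> (int N) 1 - t * flow \<omega> 0 1"
          by (simp only: right_diff_distrib[symmetric])
        then show ?case by (simp only: one_minus_cos_diff_le)
      qed
      show "integrable coins (\<lambda>\<omega>. 1 - cos (t * ?S N \<omega>))"
        by (rule Bochner_Integration.integrable_diff[OF _ int]) (simp, measurable)
      show "integrable coins (\<lambda>\<omega>. 2 * (1 - cos (t * flow \<omega> (int N) 1)) + 2 * (1 - cos (t * flow \<omega> 0 1)))"
        by (intro Bochner_Integration.integrable_add integrable_mult_right int_1)
    qed
    also have "\<dots> = 2 * G t + 2 * G t"
      by (simp only: Bochner_Integration.integral_add integrable_mult_right int_1
          integral_mult_right_zero G_shift)
    finally show ?thesis by simp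
  qed
  have G_ge: "1 / 4 \<le> G t" if "0 < t" "t < pi" for t
  proof -
    have "cos (t / 2) < 1" using that cos_monotone_0_pi[of 0 "t / 2"] by simp
    moreover have "0 < cos (t / 2)" using that by (intro cos_gt_zero) auto
    ultimately have "(cos (t / 2))\<^sup>2 < 1" by (simp add: abs_square_less_1)
    then have "(\<lambda>N. ((cos (t / 2))\<^sup>2) ^ N) \<longlonglongrightarrow> 0" by (intro LIMSEQ_power_zero) simp
    then have "(\<lambda>N. 1 - cos (t / 2) ^ (2 * N)) \<longlonglongrightarrow> 1 - 0"
      by (intro tendsto_diff tendsto_const) (simp add: power_mult)
    then have "1 - 0 \<le> 4 * G t" by (rule LIMSEQ_le_const2) (use bound in auto)
    then show ?thesis by simp
  qed
  have "(\<lambda>n. G (1 / real (Suc n))) \<longlonglongrightarrow> (\<integral>\<omega>. 1 - cos (0 * flow \<omega> 0 1) \<partial>coins)"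
    unfolding G_def
  proof (rule integral_dominated_convergence[where w="\<lambda>_. 2"])
    show "AE \<omega> in coins. (\<lambda>n. 1 - cos (1 / real (Suc n) * flow \<omega> 0 1)) \<longlonglongrightarrow> 1 - cos (0 * flow \<omega> 0 1)"
      by (intro AE_I2 tendsto_intros LIMSEQ_Suc[OF lim_1_over_n])
    show "AE \<omega> in coins. norm (1 - cos (1 / real (Suc n) * flow \<omega> 0 1)) \<le> 2" for n
      by (intro AE_I2) (simp add: abs_le_iff)
  qed auto
  then have "(\<lambda>n. G (1 / real (Suc n))) \<longlonglongrightarrow> 0" by simp
  moreover have "1 / 4 \<le> G (1 / real (Suc n))" for n
  proof (rule G_ge)
    have "1 / real (Suc n) \<le> 1" by simp
    then show "1 / real (Suc n) < pi" using pi_gt3 by linarith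
  qed simp
  ultimately have "1 / 4 \<le> (0 :: real)" by (meson LIMSEQ_le_const)
  then show False by simp
qed

section \<open>The walk driven by stacks of coins\<close>

definition arrow :: "((int \<times> int) \<times> nat \<Rightarrow> bool) \<Rightarrow> int \<times> int \<Rightarrow> nat \<Rightarrow> int \<times> int" where
  "arrow \<omega> z k = (let s = if \<omega> (z, k) then 1 else - 1 in if k = 0 then (0, s) else (s, 0))"

text \<open>The past is kept as a list so that the recursion is primitive. The number of occurrences
  of the current site in it is the number of earlier departures, hence the index of the coin to
  use.\<close>

primrec walk_state :: "((int \<times> int) \<times> nat \<Rightarrow> bool) \<Rightarrow> nat \<Rightarrow> (int \<times> int) \<times> (int \<times> int) list" where
  "walk_state \<omega> 0 = ((0, 0), [])"
| "walk_state \<omega> (Suc n) = (case walk_state \<omega> n of (z, past) \<Rightarrow> (z + arrow \<omega> z (count_list past z), z # past))"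

definition walk :: "((int \<times> int) \<times> nat \<Rightarrow> bool) \<Rightarrow> nat \<Rightarrow> int \<times> int" where
  "walk \<omega> n = fst (walk_state \<omega> n)"

text \<open>Visits strictly before time \<open>n\<close>: for the walk these are the departures made
  by time \<open>n\<close>.\<close>

definition local_time :: "(nat \<Rightarrow> 'a) \<Rightarrow> nat \<Rightarrow> 'a \<Rightarrow> nat" where
  "local_time z n x = card {i. i < n \<and> z i = x}"

lemma local_time_0 [simp]: "local_time z 0 x = 0"
  by (simp add: local_time_def)

lemma local_time_Suc [simp]: "local_time z (Suc n) x = local_time z n x + of_bool (z n = x)"
proof -
  have "{i. i < Suc n \<and> z i = x} = (if z n = x then insert n else id) {i. i < n \<and> z i = x}"
    by (auto simp: less_Suc_eq)
  then show ?thesis by (simp add: local_time_def)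
qed

lemma local_time_mono: "m \<le> n \<Longrightarrow> local_time z m x \<le> local_time z n x"
  unfolding local_time_def by (intro card_mono) auto

lemma local_time_cong: "(\<And>i. i < n \<Longrightarrow> z i = z' i) \<Longrightarrow> local_time z n x = local_time z' n x"
  unfolding local_time_def by (intro arg_cong[where f=card]) auto

lemma infinite_iff_local_time: "infinite {i. z i = x} \<longleftrightarrow> (\<forall>K. \<exists>n. K \<le> local_time z n x)"
proof
  assume inf: "infinite {i. z i = x}"
  show "\<forall>K. \<exists>n. K \<le> local_time z n x"
  proof
    fix K
    obtain A where A: "finite A" "card A = K" "A \<subseteq> {i. z i = x}"
      using infinite_arbitrarily_large[OF inf, of K] by blast
    then obtain n where "A \<subseteq> {..<n}" using finite_nat_iff_bounded by blast
    then have "card A \<le> local_time z n x"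
      unfolding local_time_def using A(3) by (intro card_mono) auto
    then show "\<exists>n. K \<le> local_time z n x" using A(2) by blast
  qed
next
  assume unbounded: "\<forall>K. \<exists>n. K \<le> local_time z n x"
  show "infinite {i. z i = x}"
  proof
    assume fin: "finite {i. z i = x}"
    obtain n where "Suc (card {i. z i = x}) \<le> local_time z n x" using unbounded by blast
    also have "\<dots> \<le> card {i. z i = x}"
      unfolding local_time_def by (rule card_mono[OF fin]) auto
    finally show False by simp
  qed
qed

lemma walk_0 [simp]: "walk \<omega> 0 = (0, 0)"
  by (simp add: walk_def)

lemma walk_Suc: "walk \<omega> (Suc n) = walk \<omega> n + arrow \<omega> (walk \<omega> n) (local_time (walk \<omega>) n (walk \<omega> n))"
proof -
  have "count_list (snd (walk_state \<omega> n)) z = local_time (walk \<omega>) n z" for z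
    by (induction n) (auto simp: walk_def split: prod.split)
  then show ?thesis by (simp add: walk_def split: prod.split) (metis snd_conv)
qed

text \<open>The walk takes the coins of \<open>z\<close> in order, one per departure: the departure
  made when the local time is \<open>m\<close> uses coin \<open>m\<close>.\<close>

lemma card_departures:
  "card {i. i < n \<and> walk \<omega> i = z \<and> walk \<omega> (Suc i) = z + e} =
   card {k. k < local_time (walk \<omega>) n z \<and> arrow \<omega> z k = e}"
proof (induction n)
  case (Suc n)
  let ?D = "\<lambda>n. {i. i < n \<and> walk \<omega> i = z \<and> walk \<omega> (Suc i) = z + e}"
  let ?K = "\<lambda>m. {k. k < m \<and> arrow \<omega> z k = e}"
  let ?m = "local_time (walk \<omega>) n z"
  show ?case
  proof (cases "walk \<omega> n = z")
    case True
    then have "walk \<omega> (Suc n) = z + e \<longleftrightarrow> arrow \<omega> z ?m = e" by (simp add: walk_Suc)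
    then have "?D (Suc n) = (if arrow \<omega> z ?m = e then insert n else id) (?D n)"
      using True by (auto simp: less_Suc_eq)
    moreover have "?K (Suc ?m) = (if arrow \<omega> z ?m = e then insert ?m else id) (?K ?m)"
      by (auto simp: less_Suc_eq)
    moreover have "n \<notin> ?D n" "?m \<notin> ?K ?m" "finite (?D n)" "finite (?K ?m)" by auto
    ultimately show ?thesis using True Suc.IH by (simp add: card_insert_disjoint)
  next
    case False
    then have "?D (Suc n) = ?D n" by (auto simp: less_Suc_eq)
    then show ?thesis using False Suc.IH by simp
  qed
qed simp

lemma recurrent_neighbour:
  assumes "infinite {i. walk \<omega> i = z}" "\<exists>\<^sub>\<infinity>k. arrow \<omega> z k = e"
  shows "infinite {i. walk \<omega> i = z + e}"
proof
  assume fin: "finite {i. walk \<omega> i = z + e}"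
  have "infinite {k. arrow \<omega> z k = e}" using assms(2) by (simp add: INFM_iff_infinite)
  from infinite_arbitrarily_large[OF this, of "Suc (card {i. walk \<omega> i = z + e})"]
  obtain A where A: "finite A" "card A = Suc (card {i. walk \<omega> i = z + e})" "A \<subseteq> {k. arrow \<omega> z k = e}"
    by blast
  obtain m where "A \<subseteq> {..<m}" using finite_nat_iff_bounded A(1) by blast
  moreover obtain n where "m \<le> local_time (walk \<omega>) n z"
    using assms(1) infinite_iff_local_time[of "walk \<omega>" z] by blast
  ultimately have "A \<subseteq> {k. k < local_time (walk \<omega>) n z \<and> arrow \<omega> z k = e}"
    using A(3) by fastforce
  then have "card A \<le> card {k. k < local_time (walk \<omega>) n z \<and> arrow \<omega> z k = e}"
    by (intro card_mono) auto
  also have "\<dots> = card {i. i < n \<and> walk \<omega> i = z \<and> walk \<omega> (Suc i) = z + e}"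
    by (rule card_departures[symmetric])
  also have "\<dots> = card (Suc ` {i. i < n \<and> walk \<omega> i = z \<and> walk \<omega> (Suc i) = z + e})"
    by (simp add: card_image)
  also have "\<dots> \<le> card {i. walk \<omega> i = z + e}"
    by (rule card_mono[OF fin]) auto
  finally show False using A(2) by simp
qed

text \<open>The times of departure towards \<open>z\<close> from the four neighbours form disjoint
  sets, and adding 1 turns them into visits to \<open>z\<close> up to time \<open>n\<close>.
  Equality can fail because the start at the origin is a visit without an arrival.\<close>

lemma local_time_ge_departures:
  "card {k. k < local_time (walk \<omega>) n (z - (0, 1)) \<and> arrow \<omega> (z - (0, 1)) k = (0, 1)} +
   card {k. k < local_time (walk \<omega>) n (z - (0, - 1)) \<and> arrow \<omega> (z - (0, - 1)) k = (0, - 1)} +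
   card {k. k < local_time (walk \<omega>) n (z - (1, 0)) \<and> arrow \<omega> (z - (1, 0)) k = (1, 0)} +
   card {k. k < local_time (walk \<omega>) n (z - (- 1, 0)) \<and> arrow \<omega> (z - (- 1, 0)) k = (- 1, 0)}
   \<le> local_time (walk \<omega>) (Suc n) z"
proof -
  define D where "D e = {i. i < n \<and> walk \<omega> i = z - e \<and> walk \<omega> (Suc i) = z}" for e
  have D: "card {k. k < local_time (walk \<omega>) n (z - e) \<and> arrow \<omega> (z - e) k = e} = card (D e)" for e
    using card_departures[of n \<omega> "z - e" e] by (simp add: D_def)
  have fin: "finite (D e)" for e by (simp add: D_def)
  have disj: "D e \<inter> D e' = {}" if "e \<noteq> e'" for e e' using that by (auto simp: D_def)
  let ?U = "D (0, 1) \<union> D (0, - 1) \<union> D (1, 0) \<union> D (- 1, 0)"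
  have "card (D (0, 1)) + card (D (0, - 1)) + card (D (1, 0)) + card (D (- 1, 0)) = card ?U"
    by (subst card_Un_disjoint; (simp add: fin disj Int_Un_distrib2)?)+
  also have "\<dots> = card (Suc ` ?U)" by (simp add: card_image)
  also have "\<dots> \<le> local_time (walk \<omega>) (Suc n) z"
    unfolding local_time_def by (rule card_mono) (auto simp: D_def)
  finally show ?thesis by (simp only: D)
qed

text \<open>The coins of the half plane on the side \<open>s \<in> {1, -1}\<close> of the line at height \<open>y\<close>, in the
  coordinates where that line has height 0 and the half plane lies above it.\<close>

definition half_plane_coins :: "int \<Rightarrow> int \<Rightarrow> ((int \<times> int) \<times> nat \<Rightarrow> bool) \<Rightarrow> int \<times> nat \<times> nat \<Rightarrow> bool" where
  "half_plane_coins s y \<omega> = (\<lambda>(x, j, k). \<omega> ((x, y + s * int j), k) = (s = 1 \<or> k \<noteq> 0))"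

text \<open>If the line at height \<open>y\<close> is recurrent, then every first departure from it takes place, so
  the numbers of visits of the walk are a supersolution of the recursion for \<open>visits\<close>.\<close>

lemma visits_le_local_time:
  assumes s: "s = 1 \<or> s = - 1" and rec: "\<And>x. infinite {i. walk \<omega> i = (x, y)}"
  shows "\<exists>T. visits (half_plane_coins s y \<omega>) n x j \<le> local_time (walk \<omega>) T (x, y + s * int j)"
proof (induction n arbitrary: x j)
  case 0
  show ?case using rec[of x] by (auto simp: infinite_iff_local_time)
next
  case (Suc n)
  let ?h = "half_plane_coins s y \<omega>"
  show ?case
  proof (cases "j = 0")
    case True
    then show ?thesis using rec[of x] by (simp add: infinite_iff_local_time)
  next
    case False
    obtain T1 where T1: "visits ?h n x (j - 1) \<le> local_time (walk \<omega>) T1 (x, y + s * int (j - 1))"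
      using Suc.IH by blast
    obtain T2 where T2: "visits ?h n x (j + 1) \<le> local_time (walk \<omega>) T2 (x, y + s * int (j + 1))"
      using Suc.IH by blast
    obtain T3 where T3: "visits ?h n (x - 1) j \<le> local_time (walk \<omega>) T3 (x - 1, y + s * int j)"
      using Suc.IH by blast
    obtain T4 where T4: "visits ?h n (x + 1) j \<le> local_time (walk \<omega>) T4 (x + 1, y + s * int j)"
      using Suc.IH by blast
    define T where "T = Max {T1, T2, T3, T4}"
    have le: "T1 \<le> T" "T2 \<le> T" "T3 \<le> T" "T4 \<le> T" by (simp_all add: T_def)
    note lt = T1[THEN order_trans, OF local_time_mono[OF le(1)]] T2[THEN order_trans, OF local_time_mono[OF le(2)]]
      T3[THEN order_trans, OF local_time_mono[OF le(3)]] T4[THEN order_trans, OF local_time_mono[OF le(4)]]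
    let ?z = "(x, y + s * int j)"
    let ?K = "\<lambda>e. card {k. k < local_time (walk \<omega>) T (?z - e) \<and> arrow \<omega> (?z - e) k = e}"
    have z: "?z - (0, s) = (x, y + s * int (j - 1))" "?z - (0, - s) = (x, y + s * int (j + 1))"
      "?z - (1, 0) = (x - 1, y + s * int j)" "?z - (- 1, 0) = (x + 1, y + s * int j)"
      using False by (simp_all add: of_nat_diff algebra_simps)
    have vertical: "of_bool (0 < m \<and> P) \<le> card {k. k < m' \<and> Q k}"
      if "m \<le> m'" "P \<Longrightarrow> Q 0" for m m' P and Q :: "nat \<Rightarrow> bool"
    proof (cases "0 < m \<and> P")
      case True
      then have "card {0 :: nat} \<le> card {k. k < m' \<and> Q k}" using that by (intro card_mono) auto
      then show ?thesis by simp
    qed auto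
    \<comment> \<open>For \<open>s = - 1\<close> the recoding negates coin 0, so that
      \<open>True\<close> always means a step away from the line at height \<open>y\<close>.\<close>
    have up: "of_bool (0 < visits ?h n x (j - 1) \<and> ?h (x, j - 1, 0)) \<le> ?K (0, s)"
      unfolding z by (rule vertical[OF lt(1)])
        (use s in \<open>auto simp: half_plane_coins_def arrow_def Let_def split: if_splits\<close>)
    have down: "of_bool (0 < visits ?h n x (j + 1) \<and> \<not> ?h (x, j + 1, 0)) \<le> ?K (0, - s)"
      unfolding z by (rule vertical[OF lt(2)])
        (use s in \<open>auto simp: half_plane_coins_def arrow_def Let_def split: if_splits\<close>)
    have right: "rights ?h (x - 1) j (visits ?h n (x - 1) j) \<le> ?K (1, 0)"
      unfolding z rights_def
      by (rule card_mono) (use lt(3) in \<open>auto simp: half_plane_coins_def arrow_def\<close>)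
    have left: "lefts ?h (x + 1) j (visits ?h n (x + 1) j) \<le> ?K (- 1, 0)"
      unfolding z lefts_def
      by (rule card_mono) (use lt(4) in \<open>auto simp: half_plane_coins_def arrow_def\<close>)
    have "visits ?h (Suc n) x j \<le> ?K (0, s) + ?K (0, - s) + ?K (1, 0) + ?K (- 1, 0)"
      using add_mono[OF add_mono[OF add_mono[OF up down] right] left] False by simp
    also have "\<dots> = ?K (0, 1) + ?K (0, - 1) + ?K (1, 0) + ?K (- 1, 0)" using s by auto
    also have "\<dots> \<le> local_time (walk \<omega>) (Suc T) ?z" by (rule local_time_ge_departures)
    finally show ?thesis by blast
  qed
qed

text \<open>Since \<open>s\<close> is 1 or -1, distinct half plane indices read distinct coins of
  the walk, so the half plane coins are again independent and fair.\<close>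

lemma AE_half_plane_coins:
  assumes "s = 1 \<or> s = - 1" "AE \<omega> in coins. P \<omega>"
  shows "AE \<omega> in coins. P (half_plane_coins s y \<omega>)"
proof -
  have "inj (\<lambda>(x, j, k). ((x, y + s * int j), k))"
    using assms(1) by (auto simp: inj_def)
  from AE_recode[OF this assms(2), of "\<lambda>(x, j, k). s = 1 \<or> k \<noteq> 0"]
  show ?thesis by (simp add: half_plane_coins_def case_prod_unfold)
qed

text \<open>The null sets are fixed in advance for every height \<open>y\<close> and both sides,
  which are countably many, so none of them depends on the walk. Off these sets recurrence spreads
  deterministically.\<close>

lemma AE_walk_recurrent_vertices: "AE \<omega> in coins. recurrent_vertices (walk \<omega>) \<in> {{}, UNIV}"
proof -
  have "AE \<omega> in coins. \<forall>y. \<forall>s\<in>{1, - 1}. \<forall>x. \<not> transient (half_plane_coins s y \<omega>) x 1"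
  proof -
    have "AE \<omega> in coins. \<forall>x. \<not> transient (half_plane_coins s y \<omega>) x 1" if "s \<in> {1, - 1}" for s y
      using that by (intro AE_half_plane_coins AE_line_1_not_transient) auto
    then show ?thesis by (simp add: AE_all_countable)
  qed
  moreover have "AE \<omega> in coins. \<forall>z b. \<exists>\<^sub>\<infinity>k. \<omega> (z :: int \<times> int, k :: nat) = b"
    unfolding AE_all_countable by (intro allI AE_coins_infinitely_often) (auto simp: inj_def)
  ultimately show ?thesis
  proof eventually_elim
    case (elim \<omega>)
    define R where "R x y \<longleftrightarrow> infinite {i. walk \<omega> i = (x, y)}" for x y
    have arrow: "\<exists>\<^sub>\<infinity>k. arrow \<omega> z k = (1, 0)" "\<exists>\<^sub>\<infinity>k. arrow \<omega> z k = (- 1, 0)" for z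
    proof -
      have "\<exists>\<^sub>\<infinity>k. \<omega> (z, k) = b \<and> k \<noteq> 0" for b
      proof (rule INFM_conjI)
        show "\<exists>\<^sub>\<infinity>k. \<omega> (z, k) = b" using elim(2) by blast
        show "\<forall>\<^sub>\<infinity>k. k \<noteq> (0 :: nat)" by (auto simp: MOST_nat)
      qed
      from INFM_mono[OF this[of True]] INFM_mono[OF this[of False]]
      show "\<exists>\<^sub>\<infinity>k. arrow \<omega> z k = (1, 0)" "\<exists>\<^sub>\<infinity>k. arrow \<omega> z k = (- 1, 0)"
        by (simp_all add: arrow_def)
    qed
    have horizontal: "R x' y" if "R x y" for x x' y
    proof (induction x' rule: int_induct[where k=x])
      case (step1 i)
      then show ?case using recurrent_neighbour[OF _ arrow(1), of "(i, y)"] by (simp add: R_def)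
    next
      case (step2 i)
      then show ?case using recurrent_neighbour[OF _ arrow(2), of "(i, y)"] by (simp add: R_def)
    qed (rule that)
    have vertical: "R x (y + s)" if line: "\<And>x. R x y" and s: "s \<in> {1, - 1}" for x y s
    proof -
      have "\<exists>n. K \<le> local_time (walk \<omega>) n (x, y + s * int 1)" for K
      proof -
        have "\<not> transient (half_plane_coins s y \<omega>) x 1" using elim(1) s by blast
        then obtain n where "K \<le> visits (half_plane_coins s y \<omega>) n x 1"
          unfolding transient_def by (meson nle_le)
        moreover obtain T where "visits (half_plane_coins s y \<omega>) n x 1 \<le> local_time (walk \<omega>) T (x, y + s * int 1)"
          using visits_le_local_time[of s \<omega> y n x 1] line s by (auto simp: R_def)
        ultimately show ?thesis using order_trans by blast
      qed
      then show ?thesis by (simp add: R_def infinite_iff_local_time)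
    qed
    have "R x' y'" if "R x y" for x y x' y'
    proof -
      have "\<forall>x'. R x' y'"
      proof (induction y' rule: int_induct[where k=y])
        case base
        show ?case using horizontal[OF that] by blast
      next
        case (step1 i)
        then show ?case using vertical[of i 1] by simp
      next
        case (step2 i)
        then show ?case using vertical[of i "- 1"] by simp
      qed
      then show ?thesis by blast
    qed
    then show ?case by (auto simp: recurrent_vertices_def R_def)
  qed
qed

section \<open>Comparison of laws\<close>

lemma measurable_arrow [measurable]: "(\<lambda>\<omega>. arrow \<omega> z k) \<in> measurable coins (count_space UNIV)"
  unfolding arrow_def by (rule measurable_compose[OF measurable_coin[of "(z, k)"]]) simp

lemma measurable_walk_state: "(\<lambda>\<omega>. walk_state \<omega> n) \<in> measurable coins (count_space UNIV)"
proof (induction n)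
  case (Suc n)
  have "(\<lambda>\<omega>. (\<lambda>st \<omega>. (fst st + arrow \<omega> (fst st) (count_list (snd st) (fst st)), fst st # snd st))
      (walk_state \<omega> n) \<omega>) \<in> measurable coins (count_space UNIV)"
  proof (rule measurable_compose_countable[OF _ Suc.IH])
    fix st :: "(int \<times> int) \<times> (int \<times> int) list"
    show "(\<lambda>\<omega>. (fst st + arrow \<omega> (fst st) (count_list (snd st) (fst st)), fst st # snd st))
        \<in> measurable coins (count_space UNIV)"
      by (rule measurable_compose[OF measurable_arrow]) simp
  qed
  then show ?case by (simp only: walk_state.simps case_prod_unfold)
qed simp

lemma measurable_walk [measurable]: "(\<lambda>\<omega>. walk \<omega> n) \<in> measurable coins (count_space UNIV)"
  unfolding walk_def by (rule measurable_compose[OF measurable_walk_state]) simp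

text \<open>The coin due at time \<open>n\<close> has not been read before, so changing it cannot
  affect the path up to that time.\<close>

lemma walk_determined:
  assumes "\<And>i. i \<noteq> (z n, local_time z n (z n)) \<Longrightarrow> \<omega>' i = \<omega> i" "\<forall>k\<le>n. walk \<omega> k = z k" "k \<le> n"
  shows "walk \<omega>' k = z k"
  using \<open>k \<le> n\<close>
proof (induction k rule: less_induct)
  case (less k)
  show ?case
  proof (cases k)
    case 0
    then show ?thesis using assms(2) by auto
  next
    case (Suc l)
    then have l: "l < n" "walk \<omega>' l = z l" using less by auto
    have "local_time (walk \<omega>') l (z l) = local_time z l (z l)"
      using less Suc by (intro local_time_cong) auto
    moreover have "local_time (walk \<omega>) l (z l) = local_time z l (z l)"
      using assms(2) l by (intro local_time_cong) auto
    moreover have "arrow \<omega>' (z l) (local_time z l (z l)) = arrow \<omega> (z l) (local_time z l (z l))"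
    proof -
      \<comment> \<open>The coin used at time \<open>l < n\<close> has an index below the number of
        visits to \<open>z l\<close> before time \<open>n\<close>; it is therefore not the coin due
        at time \<open>n\<close>, even if the two sites coincide.\<close>
      have "local_time z l (z l) < local_time z n (z l)"
        using local_time_mono[of "Suc l" n z "z l"] l by simp
      then have "(z l, local_time z l (z l)) \<noteq> (z n, local_time z n (z n))" by auto
      then show ?thesis using assms(1) by (simp add: arrow_def)
    qed
    ultimately have "walk \<omega>' (Suc l) = walk \<omega> (Suc l)"
      using l assms(2) by (simp add: walk_Suc)
    then show ?thesis using Suc assms(2) less.prems by simp
  qed
qed

lemma pmf_berw_step:
  "pmf (berw_step z n) y =
    (let e = if local_time z n (z n) = 0 then (0, 1) else (1, 0) in of_bool (y = z n + e \<or> y = z n - e) / 2)"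
proof -
  have "local_time z n (z n) = 0 \<longleftrightarrow> (\<forall>k<n. z k \<noteq> z n)"
    by (auto simp: local_time_def)
  moreover have "z n + (0, 1) \<noteq> z n - (0, 1)" "z n + (1, 0) \<noteq> z n - (1, 0)"
    by (auto simp: prod_eq_iff)
  ultimately show ?thesis
    by (auto simp: berw_step_def Let_def pmf_of_set indicator_def)
qed

text \<open>On the event of a given path the next step is decided by a coin that the path has not
  read, and \<open>prob_coin_flip_invariant\<close> shows it to be fair there.\<close>

lemma prob_walk_step:
  "measure coins {\<omega>. \<forall>k\<le>Suc n. walk \<omega> k = z k} =
    measure coins {\<omega>. \<forall>k\<le>n. walk \<omega> k = z k} * pmf (berw_step z n) (z (Suc n))"
proof -
  let ?m = "local_time z n (z n)"
  let ?A = "{\<omega>. \<forall>k\<le>n. walk \<omega> k = z k}"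
  define e :: "int \<times> int" where "e = (if ?m = 0 then (0, 1) else (1, 0))"
  have A: "?A \<in> sets coins" by (rule sets_coins_Collect) measurable
  have half: "measure coins {\<omega>\<in>?A. \<omega> (z n, ?m) = b} = measure coins ?A / 2" for b
  proof (rule prob_coin_flip_invariant[OF A])
    fix \<omega> \<omega>' :: "(int \<times> int) \<times> nat \<Rightarrow> bool"
    assume agree: "\<And>i'. i' \<noteq> (z n, ?m) \<Longrightarrow> \<omega>' i' = \<omega> i'" and path: "\<omega> \<in> ?A"
    show "\<omega>' \<in> ?A" using walk_determined[OF agree] path by simp
  qed
  have step: "walk \<omega> (Suc n) = z n + (if \<omega> (z n, ?m) then e else - e)" if "\<omega> \<in> ?A" for \<omega>
  proof -
    have "local_time (walk \<omega>) n (z n) = ?m" using that by (intro local_time_cong) auto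
    then show ?thesis using that by (simp add: walk_Suc arrow_def Let_def e_def)
  qed
  have "{\<omega>. \<forall>k\<le>Suc n. walk \<omega> k = z k} = {\<omega>\<in>?A. walk \<omega> (Suc n) = z (Suc n)}"
    by (auto simp: le_Suc_eq)
  also have "\<dots> = {\<omega>\<in>?A. z (Suc n) = z n + (if \<omega> (z n, ?m) then e else - e)}"
    using step by (intro Collect_cong conj_cong refl) (metis (no_types, lifting))
  finally have eq: "{\<omega>. \<forall>k\<le>Suc n. walk \<omega> k = z k} =
    {\<omega>\<in>?A. z (Suc n) = z n + (if \<omega> (z n, ?m) then e else - e)}" .
  have ne: "e \<noteq> - e" by (simp add: e_def prod_eq_iff)
  consider "z (Suc n) = z n + e" | "z (Suc n) = z n - e" | "z (Suc n) \<noteq> z n + e" "z (Suc n) \<noteq> z n - e"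
    by blast
  then show ?thesis
  proof cases
    case 1
    then have "{\<omega>. \<forall>k\<le>Suc n. walk \<omega> k = z k} = {\<omega>\<in>?A. \<omega> (z n, ?m) = True}"
      unfolding eq using ne by auto
    moreover have "pmf (berw_step z n) (z (Suc n)) = 1 / 2"
      unfolding pmf_berw_step Let_def e_def[symmetric] using 1 by simp
    ultimately show ?thesis by (simp only: half mult_1_right times_divide_eq_right)
  next
    case 2
    then have "z (Suc n) = z n + - e" by simp
    then have "{\<omega>. \<forall>k\<le>Suc n. walk \<omega> k = z k} = {\<omega>\<in>?A. \<omega> (z n, ?m) = False}"
      unfolding eq using ne by auto
    moreover have "pmf (berw_step z n) (z (Suc n)) = 1 / 2"
      unfolding pmf_berw_step Let_def e_def[symmetric] using 2 by simp
    ultimately show ?thesis by (simp only: half mult_1_right times_divide_eq_right)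
  next
    case 3
    then have "{\<omega>. \<forall>k\<le>Suc n. walk \<omega> k = z k} = {}"
      unfolding eq by auto
    moreover have "pmf (berw_step z n) (z (Suc n)) = 0"
      unfolding pmf_berw_step Let_def e_def[symmetric] using 3 by simp
    ultimately show ?thesis by (simp only: measure_empty mult_zero_right)
  qed
qed

lemma (in balanced_excited_random_walk) prob_path:
  "prob {\<omega>\<in>space M. \<forall>k\<le>n. Z k \<omega> = z k} = measure coins {\<omega>. \<forall>k\<le>n. walk \<omega> k = z k}"
proof (induction n)
  case 0
  show ?case
  proof (cases "z 0 = (0, 0)")
    case True
    have "{\<omega>\<in>space M. Z 0 \<omega> = (0, 0)} \<in> events"
      using measurable_sets[OF measurable_Z, of "{(0, 0)}" 0] by (simp add: vimage_def Int_def conj_commute)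
    then have "prob {\<omega>\<in>space M. Z 0 \<omega> = (0, 0)} = 1"
      using start prob_Collect_eq_1[of "\<lambda>\<omega>. Z 0 \<omega> = (0, 0)"] by simp
    then show ?thesis using True coins.prob_space by simp
  next
    case False
    have "{\<omega>\<in>space M. Z 0 \<omega> = z 0} \<in> events"
      using measurable_sets[OF measurable_Z, of "{z 0}" 0] by (simp add: vimage_def Int_def conj_commute)
    moreover have "AE \<omega> in M. Z 0 \<omega> \<noteq> z 0" using start by eventually_elim (use False in auto)
    ultimately have "prob {\<omega>\<in>space M. Z 0 \<omega> = z 0} = 0"
      using prob_Collect_eq_0[of "\<lambda>\<omega>. Z 0 \<omega> = z 0"] by simp
    moreover have "{\<omega>. \<forall>k\<le>0. walk \<omega> k = z k} = {}"
      using False walk_0 by (metis (mono_tags, lifting) empty_Collect_eq le_refl)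
    ultimately show ?thesis by simp
  qed
next
  case (Suc n)
  note [measurable] = measurable_Z
  let ?A = "{\<omega>\<in>space M. \<forall>k\<le>n. Z k \<omega> = z k}"
  let ?B = "{\<omega>\<in>space M. \<forall>k\<le>Suc n. Z k \<omega> = z k}"
  have sub: "?B \<subseteq> ?A" by auto
  have A: "?A \<in> events" by measurable
  have "prob ?B = prob ?A * pmf (berw_step z n) (z (Suc n))"
  proof (cases "prob ?A > 0")
    case True
    have "{\<omega>\<in>space M. Z (Suc n) \<omega> = z (Suc n) \<and> (\<forall>k\<le>n. Z k \<omega> = z k)} = ?B"
      by (auto simp: le_Suc_eq)
    with step[OF True, of "z (Suc n)"] True show ?thesis
      by (simp add: cond_prob_def field_simps)
  next
    case False
    \<comment> \<open>The assumption \<open>step\<close> says nothing about a past of probability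
      zero; there monotonicity makes both sides vanish.\<close>
    then have "prob ?A = 0" using measure_nonneg[of M ?A] by linarith
    moreover have "prob ?B \<le> prob ?A" by (rule finite_measure_mono[OF sub A])
    ultimately show ?thesis using measure_nonneg[of M ?B] by simp
  qed
  then show ?case by (simp only: Suc.IH prob_walk_step)
qed

lemma measurable_sequence:
  assumes "\<And>n. U n \<in> measurable M (count_space UNIV)"
  shows "(\<lambda>\<omega> n. U n \<omega>) \<in> measurable M (PiM UNIV (\<lambda>_. count_space UNIV))"
proof -
  have "(\<lambda>\<omega>. \<lambda>n\<in>UNIV. U n \<omega>) \<in> measurable M (PiM UNIV (\<lambda>_. count_space UNIV))"
    by (rule measurable_restrict) (rule assms)
  then show ?thesis by (simp add: restrict_def)
qed

text \<open>Finite paths form a countable type, so their laws are determined by the point masses in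
  \<open>paths\<close>. A cylinder over \<open>J\<close> depends only on the path up to a bound of
  \<open>J\<close>, and cylinders determine a finite measure on the product.\<close>

lemma distr_eq_PiM_count_space:
  fixes X :: "nat \<Rightarrow> 'a \<Rightarrow> 'c::countable" and Y :: "nat \<Rightarrow> 'b \<Rightarrow> 'c"
  assumes M: "finite_measure M" and N: "finite_measure N"
    and X: "\<And>n. X n \<in> measurable M (count_space UNIV)" and Y: "\<And>n. Y n \<in> measurable N (count_space UNIV)"
    and paths: "\<And>n z. measure M {\<omega>\<in>space M. \<forall>k\<le>n. X k \<omega> = z k} = measure N {\<omega>\<in>space N. \<forall>k\<le>n. Y k \<omega> = z k}"
  shows "distr M (PiM UNIV (\<lambda>_. count_space UNIV)) (\<lambda>\<omega> n. X n \<omega>) =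
    distr N (PiM UNIV (\<lambda>_. count_space UNIV)) (\<lambda>\<omega> n. Y n \<omega>)"
proof -
  interpret M: finite_measure M by (rule M)
  interpret N: finite_measure N by (rule N)
  let ?S = "PiM UNIV (\<lambda>_::nat. count_space (UNIV :: 'c set))"
  have meas_list: "(\<lambda>\<omega>. map (\<lambda>k. U k \<omega>) [0..<n]) \<in> measurable L (count_space UNIV)"
    if U: "\<And>n. U n \<in> measurable L (count_space UNIV)" for U :: "nat \<Rightarrow> 'x \<Rightarrow> 'c" and L n
  proof (induction n)
    case (Suc n)
    have "(\<lambda>\<omega>. (\<lambda>l \<omega>. l @ [U n \<omega>]) (map (\<lambda>k. U k \<omega>) [0..<n]) \<omega>) \<in> measurable L (count_space UNIV)"
    proof (rule measurable_compose_countable[OF _ Suc.IH])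
      fix l :: "'c list"
      show "(\<lambda>\<omega>. l @ [U n \<omega>]) \<in> measurable L (count_space UNIV)"
        by (rule measurable_compose[OF U]) simp
    qed
    then show ?case by simp
  qed simp
  have list_eq: "distr M (count_space UNIV) (\<lambda>\<omega>. map (\<lambda>k. X k \<omega>) [0..<Suc n]) =
      distr N (count_space UNIV) (\<lambda>\<omega>. map (\<lambda>k. Y k \<omega>) [0..<Suc n])" (is "?DX = ?DY") for n
  proof (rule measure_eqI_countable[of _ UNIV])
    fix l :: "'c list"
    have *: "{\<omega>\<in>space L. map (\<lambda>k. U k \<omega>) [0..<Suc n] = l} =
        (if length l = Suc n then {\<omega>\<in>space L. \<forall>k\<le>n. U k \<omega> = l ! k} else {})"
      for L :: "'x measure" and U :: "nat \<Rightarrow> 'x \<Rightarrow> 'c"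
      by (auto simp: list_eq_iff_nth_eq less_Suc_eq_le simp del: upt_Suc)
    have "emeasure ?DX {l} = emeasure M {\<omega>\<in>space M. map (\<lambda>k. X k \<omega>) [0..<Suc n] = l}"
      by (subst emeasure_distr[OF meas_list[OF X]]) (auto intro!: arg_cong[where f="emeasure M"])
    also have "\<dots> = emeasure N {\<omega>\<in>space N. map (\<lambda>k. Y k \<omega>) [0..<Suc n] = l}"
      unfolding * by (simp add: M.emeasure_eq_measure N.emeasure_eq_measure paths)
    also have "\<dots> = emeasure ?DY {l}"
      by (subst emeasure_distr[OF meas_list[OF Y]]) (auto intro!: arg_cong[where f="emeasure N"])
    finally show "emeasure ?DX {l} = emeasure ?DY {l}" .
  qed auto
  show ?thesis
  proof (rule measure_eqI_PiM_infinite)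
    show "finite_measure (distr M ?S (\<lambda>\<omega> n. X n \<omega>))"
      by (rule M.finite_measure_distr[OF measurable_sequence[OF X]])
    fix J :: "nat set" and A :: "nat \<Rightarrow> 'c set"
    assume J: "finite J"
    then obtain n where n: "J \<subseteq> {..n}" using finite_nat_iff_bounded_le by blast
    let ?C = "prod_emb UNIV (\<lambda>_. count_space UNIV) J (Pi\<^sub>E J A)"
    let ?L = "{l. \<forall>j\<in>J. l ! j \<in> A j}"
    have C: "?C \<in> sets ?S" using J by (intro sets_PiM_I) auto
    have vim: "(\<lambda>\<omega> n. U n \<omega>) -` ?C \<inter> space L = (\<lambda>\<omega>. map (\<lambda>k. U k \<omega>) [0..<Suc n]) -` ?L \<inter> space L"
      for U :: "nat \<Rightarrow> 'x \<Rightarrow> 'c" and L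
    proof -
      have "map (\<lambda>k. U k \<omega>) [0..<Suc n] ! j = U j \<omega>" if "j \<in> J" for j \<omega>
        using that n by (subst nth_map_upt) auto
      then show ?thesis by (auto simp: prod_emb_def simp del: upt_Suc)
    qed
    have "emeasure (distr M ?S (\<lambda>\<omega> n. X n \<omega>)) ?C =
        emeasure (distr M (count_space UNIV) (\<lambda>\<omega>. map (\<lambda>k. X k \<omega>) [0..<Suc n])) ?L"
      by (simp only: emeasure_distr[OF measurable_sequence[OF X] C] vim emeasure_distr[OF meas_list[OF X]]
          sets_count_space Pow_UNIV UNIV_I)
    also have "\<dots> = emeasure (distr N ?S (\<lambda>\<omega> n. Y n \<omega>)) ?C"
      by (simp only: list_eq emeasure_distr[OF measurable_sequence[OF Y] C] vim emeasure_distr[OF meas_list[OF Y]]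
          sets_count_space Pow_UNIV UNIV_I)
    finally show "emeasure (distr M ?S (\<lambda>\<omega> n. X n \<omega>)) ?C = emeasure (distr N ?S (\<lambda>\<omega> n. Y n \<omega>)) ?C" .
  qed simp_all
qed

theorem theorem1p1:
  fixes M :: "'w measure" and Z :: "nat \<Rightarrow> 'w \<Rightarrow> int \<times> int"
  assumes "balanced_excited_random_walk M Z"
  shows "\<P>(\<omega> in M. recurrent_vertices (\<lambda>n. Z n \<omega>) \<in> {{}, UNIV}) = 1"
proof -
  interpret balanced_excited_random_walk M Z by (rule assms)
  let ?S = "PiM UNIV (\<lambda>_::nat. count_space (UNIV :: (int \<times> int) set))"
  let ?G = "{z. recurrent_vertices z \<in> {{}, UNIV}} :: (nat \<Rightarrow> int \<times> int) set"
  have law: "distr M ?S (\<lambda>\<omega> n. Z n \<omega>) = distr coins ?S (\<lambda>\<omega> n. walk \<omega> n)"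
    by (rule distr_eq_PiM_count_space)
      (use measurable_Z prob_path in \<open>simp_all add: finite_measure_axioms coins.finite_measure_axioms\<close>)
  have G: "?G \<in> sets ?S"
  proof -
    \<comment> \<open>Infinitely many visits are spelled out with quantifiers over times and sites,
      both countable, so that measurability follows.\<close>
    have "{z\<in>space ?S. (\<forall>x. \<not> (\<forall>m. \<exists>n\<ge>m. z n = x)) \<or> (\<forall>x. \<forall>m. \<exists>n\<ge>m. z n = x)} \<in> sets ?S"
      by measurable
    also have "{z\<in>space ?S. (\<forall>x. \<not> (\<forall>m. \<exists>n\<ge>m. z n = x)) \<or> (\<forall>x. \<forall>m. \<exists>n\<ge>m. z n = x)} = ?G"
      by (simp add: space_PiM recurrent_vertices_def infinite_nat_iff_unbounded_le set_eq_iff)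
    finally show ?thesis .
  qed
  have "{\<omega>\<in>space M. recurrent_vertices (\<lambda>n. Z n \<omega>) \<in> {{}, UNIV}} = (\<lambda>\<omega> n. Z n \<omega>) -` ?G \<inter> space M"
    by auto
  then have "\<P>(\<omega> in M. recurrent_vertices (\<lambda>n. Z n \<omega>) \<in> {{}, UNIV}) = measure (distr M ?S (\<lambda>\<omega> n. Z n \<omega>)) ?G"
    by (simp only: measure_distr[OF measurable_sequence[OF measurable_Z] G])
  also have "\<dots> = measure coins {\<omega>. recurrent_vertices (walk \<omega>) \<in> {{}, UNIV}}"
    unfolding law by (subst measure_distr[OF measurable_sequence[OF measurable_walk] G]) (simp add: vimage_def)
  also have "\<dots> = 1"
  proof -
    have "(\<lambda>\<omega> n. walk \<omega> n) -` ?G \<inter> space coins \<in> sets coins"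
      by (rule measurable_sets[OF measurable_sequence[OF measurable_walk] G])
    then have "{\<omega>\<in>space coins. recurrent_vertices (walk \<omega>) \<in> {{}, UNIV}} \<in> sets coins"
      by (simp add: vimage_def)
    then show ?thesis
      using AE_walk_recurrent_vertices coins.prob_Collect_eq_1[of "\<lambda>\<omega>. recurrent_vertices (walk \<omega>) \<in> {{}, UNIV}"]
      by simp
  qed
  finally show ?thesis .
qed

end
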